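(* Let $F=(F,\mathcal T,\nu,\mathcal G)$ be a $\nu$-bipotent, $\nu$-archimedean, complete $\nu$-semifield$^\dagger$ and $\Lambda=\{\lambda_1,\dots,\lambda_n\}$. Let $\langle F\rangle$ be the $\nu$-kernel of $\overline{F(\Lambda)}$ generated by the constant functions, and let $\mathcal P(\langle F\rangle)$ be the lattice (under product and intersection) of principal $\nu$-kernels contained in $\langle F\rangle$. Then the lattice $\mathcal P(\langle F\rangle)$ is generated by the principal corner internal $\nu$-kernels, and the sublattice of regular principal $\nu$-kernels is generated by the regular, principal corner internal $\nu$-kernels.
   Context: **$\nu$-structures.** A semiring$^\dagger$ is a commutative semiring with unit $1$, not required to have a zero (and containing $r_0,r_1$ with $r_0+r_1=1$). A $\nu$-domain$^\dagger$ is a quadruple $(R,\mathcal T,\nu,\mathcal G)$ with $R$ a semiring$^\dagger$, $\mathcal T\subset R$ a cancellative multiplicative submonoid (tangible elements), $\mathcal G$ an ideal of $R$ (ghost elements) with a partial order, and $\nu:R\to\mathcal G$ an idempotent homomorphism with $\nu|_{\mathcal T}$ onto, such that $a+b=a$ if $\nu(a)>\nu(b)$ and $a+b=\nu(a)$ if $\nu(a)=\nu(b)$. It is a $\nu$-semifield$^\dagger$ if $\mathcal T$ is an abelian group, $\nu$-bipotent if $a+b\in\{a,b,a^\nu\}$ always, $\nu$-archimedean if $a^{k}\le_\nu b$ for all $k\in\mathbb Z$ implies $a\cong_\nu1$, and complete if bounded subsets (with respect to $\nu$-values) have suprema and infima. Write $a^\nu=\nu(a)$; $a\cong_\nu b$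 means $a^\nu=b^\nu$; $a\ge_\nu b$ means $a^\nu\ge b^\nu$. Set $a^*=a^{-1}$, $(a^\nu)^*=(a^{-1})^\nu$ for $a\in\mathcal T$. **Rational functions.** $\overline{F[\Lambda]}$ is the semiring$^\dagger$ of functions $F^{(n)}\to F$ defined by polynomials over $F$, and $\overline{\mathcal T[\Lambda]}$ its subset defined by polynomials with tangible coefficients. $\overline{F(\Lambda)}$ is the localization of $\overline{F[\Lambda]}$ at $\overline{\mathcal T[\Lambda]}$; its elements $h/g$ are regarded as functions $\mathbf a\mapsto h(\mathbf a)g(\mathbf a)^*$ with pointwise operations. **Kernels.** A $\nu$-kernel of $\overline{F(\Lambda)}$ is a subgroup $K$ (closed under products and $*$) such that $a,b\in K$, $\alpha+\beta\cong_\nu1$ imply $\alpha a+\beta b\in K$; as in the paper these are handled up to $\cong_\nu$. $\langle S\rangle$ is the $\nu$-kernel generated by $S$; a $\nu$-kernel is principal if it is $\langle f\rangle$ for one element $f$; $K_1K_2=\{ab:a\in K_1,b\in K_2\}$. Principal $\nu$-kernels form a lattice under product and intersection. **Corner internal, regular.** A kernel root of $f$ is a point $\mathbf a$ with $f(\mathbf a)\cong_\nu1$; $1_{\mathrm{loc}}(f)$ is the set of kernel roots. A ghost root of a polynomial $p$ is a (tangible) point $\mathbf a$ with $p(\mathbf a)\in\mathcal G$. $f\in\overline{F(\Lambda)}$ is corner internal if one can write $f=h/g$ with polynomials $g,h$, $g\in\overline{\mathcal T[\Lambda]}$, such that every ghost root of $g+h$ is a kernel root of $f$. $f=h/g$ is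 regular if for each $\mathbf a\in1_{\mathrm{loc}}(f)$, every $\nu$-neighborhood of $\mathbf a$ (order topology on $\nu$-values) contains a point at which $h$ and $g$ do not agree (up to $\cong_\nu$). A principal $\nu$-kernel is corner internal (resp. regular) if it has a corner internal (resp. regular) generator.
   Formalization: Tangible and ghost elements are assumed disjoint (for ν the identity on max-plus the claim is false), and the order on ghosts is assumed to be that of addition, x ≤ y iff x+y=y (for the equality order regular kernels are not closed under intersection). *)

theory Defs
  imports "HOL-Analysis.Analysis"
begin

section \<open>$\nu$-structures\<close>

text \<open>The semiring without zero is the whole type. Being a semiring without zero, it has sort
  \<open>{comm_semiring, comm_monoid_mult}\<close>, and not \<open>comm_semiring_1\<close>. The order on the ghost elements
  is a relation, \<open>(x, y) \<in> ghost_le F\<close> meaning \<open>x \<le> y\<close>.\<close>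

record 'a nu_structure =
  tangible :: "'a set"
  nu :: "'a \<Rightarrow> 'a"
  ghost :: "'a set"
  ghost_le :: "'a rel"

text \<open>Two conventions are made explicit.
  \<open>tangible_ghost_disjoint\<close> excludes the degenerate case \<open>\<nu> = id\<close>, in which every element is
  both tangible and ghost and every point is a ghost root of every polynomial.
  \<open>add_imp_ghost_le\<close> says that the order on the ghost elements is the one given by addition
  (\<open>x \<le> y\<close> iff \<open>x + y = y\<close>); the other implication follows from \<open>add_dominant\<close> and
  \<open>add_same\<close>. Without it, the equality relation would be an admissible order.\<close>

locale nu_domain =
  fixes F :: "'a::{comm_semiring,comm_monoid_mult} nu_structure"
  assumes ex_sum_one: "\<exists>r0 r1 :: 'a. r0 + r1 = 1"
    and tangible_one: "1 \<in> tangible F"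
    and tangible_mult: "\<lbrakk>a \<in> tangible F; b \<in> tangible F\<rbrakk> \<Longrightarrow> a * b \<in> tangible F"
    and tangible_cancel: "\<lbrakk>a \<in> tangible F; b \<in> tangible F; c \<in> tangible F; a * b = a * c\<rbrakk> \<Longrightarrow> b = c"
    and ghost_add: "\<lbrakk>x \<in> ghost F; y \<in> ghost F\<rbrakk> \<Longrightarrow> x + y \<in> ghost F"
    and ghost_mult: "x \<in> ghost F \<Longrightarrow> a * x \<in> ghost F"
    and tangible_ghost_disjoint: "tangible F \<inter> ghost F = {}"
    and ghost_partial_order: "partial_order_on (ghost F) (ghost_le F)"
    and add_imp_ghost_le: "\<lbrakk>x \<in> ghost F; y \<in> ghost F; x + y = y\<rbrakk> \<Longrightarrow> (x, y) \<in> ghost_le F"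
    and nu_ghost: "nu F a \<in> ghost F"
    and nu_add: "nu F (a + b) = nu F a + nu F b"
    and nu_mult: "nu F (a * b) = nu F a * nu F b"
    and nu_idem: "nu F (nu F a) = nu F a"
    and nu_tangible_onto: "nu F ` tangible F = ghost F"
    and add_dominant: "\<lbrakk>(nu F b, nu F a) \<in> ghost_le F; nu F b \<noteq> nu F a\<rbrakk> \<Longrightarrow> a + b = a"
    and add_same: "nu F a = nu F b \<Longrightarrow> a + b = nu F a"

locale nu_semifield = nu_domain +
  assumes tangible_inverse: "a \<in> tangible F \<Longrightarrow> \<exists>b \<in> tangible F. a * b = 1"

definition nu_eq :: "('a::{comm_semiring,comm_monoid_mult}) nu_structure \<Rightarrow> 'a \<Rightarrow> 'a \<Rightarrow> bool" where
  "nu_eq F a b \<longleftrightarrow> nu F a = nu F b"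

definition nu_le :: "('a::{comm_semiring,comm_monoid_mult}) nu_structure \<Rightarrow> 'a \<Rightarrow> 'a \<Rightarrow> bool" where
  "nu_le F a b \<longleftrightarrow> (nu F a, nu F b) \<in> ghost_le F"

definition nu_less :: "('a::{comm_semiring,comm_monoid_mult}) nu_structure \<Rightarrow> 'a \<Rightarrow> 'a \<Rightarrow> bool" where
  "nu_less F a b \<longleftrightarrow> nu_le F a b \<and> \<not> nu_eq F a b"

definition tangible_inv :: "('a::{comm_semiring,comm_monoid_mult}) nu_structure \<Rightarrow> 'a \<Rightarrow> 'a" where
  "tangible_inv F a = (THE b. b \<in> tangible F \<and> a * b = 1)"

text \<open>On a ghost element \<open>t\<^sup>\<nu>\<close> with \<open>t\<close> tangible, the operation \<open>*\<close> is \<open>(t\<^sup>-\<^sup>1)\<^sup>\<nu>\<close>, which does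
  not depend on the choice of \<open>t\<close>. The same clause covers possible elements outside
  \<open>tangible F \<union> ghost F\<close>, so that \<open>*\<close> is total.\<close>

definition star :: "('a::{comm_semiring,comm_monoid_mult}) nu_structure \<Rightarrow> 'a \<Rightarrow> 'a" where
  "star F a = (if a \<in> tangible F then tangible_inv F a
     else nu F (tangible_inv F (SOME t. t \<in> tangible F \<and> nu F t = nu F a)))"

definition int_power :: "('a::{comm_semiring,comm_monoid_mult}) nu_structure \<Rightarrow> 'a \<Rightarrow> int \<Rightarrow> 'a" where
  "int_power F a k = (if 0 \<le> k then a ^ nat k else star F a ^ nat (- k))"

definition nu_bipotent :: "('a::{comm_semiring,comm_monoid_mult}) nu_structure \<Rightarrow> bool" where
  "nu_bipotent F \<longleftrightarrow> (\<forall>a b. a + b \<in> {a, b, nu F a})"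

definition nu_archimedean :: "('a::{comm_semiring,comm_monoid_mult}) nu_structure \<Rightarrow> bool" where
  "nu_archimedean F \<longleftrightarrow> (\<forall>a b. (\<forall>k. nu_le F (int_power F a k) b) \<longrightarrow> nu_eq F a 1)"

definition nu_complete :: "('a::{comm_semiring,comm_monoid_mult}) nu_structure \<Rightarrow> bool" where
  "nu_complete F \<longleftrightarrow> (\<forall>S. S \<noteq> {} \<and> (\<exists>l. \<forall>s\<in>S. nu_le F l s) \<and> (\<exists>u. \<forall>s\<in>S. nu_le F s u) \<longrightarrow>
     (\<exists>u. (\<forall>s\<in>S. nu_le F s u) \<and> (\<forall>v. (\<forall>s\<in>S. nu_le F s v) \<longrightarrow> nu_le F u v)) \<and>
     (\<exists>l. (\<forall>s\<in>S. nu_le F l s) \<and> (\<forall>v. (\<forall>s\<in>S. nu_le F v s) \<longrightarrow> nu_le F v l)))"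


section \<open>Polynomial and rational functions\<close>

text \<open>The finite type \<open>'n\<close> indexes the indeterminates, and points are functions \<open>'n \<Rightarrow> 'a\<close>. In the
  absence of a zero, a polynomial is a nonempty list of pairs (coefficient, exponent vector)
  with pairwise distinct exponent vectors; the library sums need a zero.\<close>

fun sum_nonempty :: "'a::plus list \<Rightarrow> 'a" where
  "sum_nonempty [x] = x"
| "sum_nonempty (x # y # xs) = x + sum_nonempty (y # xs)"

definition poly_eval ::
  "('a::{comm_semiring,comm_monoid_mult} \<times> ('n::finite \<Rightarrow> nat)) list \<Rightarrow> ('n \<Rightarrow> 'a) \<Rightarrow> 'a" where
  "poly_eval ms a = sum_nonempty (map (\<lambda>(c, e). c * (\<Prod>i\<in>UNIV. a i ^ e i)) ms)"

definition poly_funs :: "(('n::finite \<Rightarrow> 'a::{comm_semiring,comm_monoid_mult}) \<Rightarrow> 'a) set" where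
  "poly_funs = {poly_eval ms | ms. ms \<noteq> [] \<and> distinct (map snd ms)}"

definition tangible_poly_funs ::
  "('a::{comm_semiring,comm_monoid_mult}) nu_structure \<Rightarrow> (('n::finite \<Rightarrow> 'a) \<Rightarrow> 'a) set" where
  "tangible_poly_funs F =
     {poly_eval ms | ms. ms \<noteq> [] \<and> distinct (map snd ms) \<and> fst ` set ms \<subseteq> tangible F}"

definition quot_fun ::
  "('a::{comm_semiring,comm_monoid_mult}) nu_structure \<Rightarrow>
    (('n \<Rightarrow> 'a) \<Rightarrow> 'a) \<Rightarrow> (('n \<Rightarrow> 'a) \<Rightarrow> 'a) \<Rightarrow> ('n \<Rightarrow> 'a) \<Rightarrow> 'a" where
  "quot_fun F h g = (\<lambda>a. h a * star F (g a))"

definition rat_funs ::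
  "('a::{comm_semiring,comm_monoid_mult}) nu_structure \<Rightarrow> (('n::finite \<Rightarrow> 'a) \<Rightarrow> 'a) set" where
  "rat_funs F = {quot_fun F h g | h g. h \<in> poly_funs \<and> g \<in> tangible_poly_funs F}"

definition nu_eq_fun ::
  "('a::{comm_semiring,comm_monoid_mult}) nu_structure \<Rightarrow>
    (('n \<Rightarrow> 'a) \<Rightarrow> 'a) \<Rightarrow> (('n \<Rightarrow> 'a) \<Rightarrow> 'a) \<Rightarrow> bool" where
  "nu_eq_fun F f g \<longleftrightarrow> (\<forall>a. nu_eq F (f a) (g a))"


section \<open>$\nu$-kernels\<close>

text \<open>Kernels are taken up to \<open>\<cong>\<^sub>\<nu>\<close>: they are unions of \<open>\<cong>\<^sub>\<nu>\<close>-classes of rational functions.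
  Accordingly, each operation is followed by passing to all rational functions that are
  \<open>\<cong>\<^sub>\<nu>\<close> to the pointwise result (the pointwise result itself need not be of the form \<open>h/g\<close>
  on the nose, since \<open>g * g\<^sup>*\<close> is only \<open>\<cong>\<^sub>\<nu> 1\<close>).\<close>

definition nu_class ::
  "('a::{comm_semiring,comm_monoid_mult}) nu_structure \<Rightarrow>
    (('n::finite \<Rightarrow> 'a) \<Rightarrow> 'a) \<Rightarrow> (('n \<Rightarrow> 'a) \<Rightarrow> 'a) set" where
  "nu_class F f = {c \<in> rat_funs F. nu_eq_fun F c f}"

definition nu_kernel ::
  "('a::{comm_semiring,comm_monoid_mult}) nu_structure \<Rightarrow> (('n::finite \<Rightarrow> 'a) \<Rightarrow> 'a) set \<Rightarrow> bool" where
  "nu_kernel F K \<longleftrightarrow> K \<subseteq> rat_funs F \<and> K \<noteq> {} \<and>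
     (\<forall>f\<in>K. nu_class F f \<subseteq> K) \<and>
     (\<forall>f\<in>K. \<forall>g\<in>K. nu_class F (\<lambda>a. f a * g a) \<subseteq> K) \<and>
     (\<forall>f\<in>K. nu_class F (\<lambda>a. star F (f a)) \<subseteq> K) \<and>
     (\<forall>f\<in>K. \<forall>g\<in>K. \<forall>\<alpha>\<in>rat_funs F. \<forall>\<beta>\<in>rat_funs F.
        nu_eq_fun F (\<lambda>a. \<alpha> a + \<beta> a) (\<lambda>a. 1) \<longrightarrow>
        nu_class F (\<lambda>a. \<alpha> a * f a + \<beta> a * g a) \<subseteq> K)"

definition kernel_gen ::
  "('a::{comm_semiring,comm_monoid_mult}) nu_structure \<Rightarrow>
    (('n::finite \<Rightarrow> 'a) \<Rightarrow> 'a) set \<Rightarrow> (('n \<Rightarrow> 'a) \<Rightarrow> 'a) set" where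
  "kernel_gen F S = \<Inter> {K. nu_kernel F K \<and> S \<subseteq> K}"

definition kernel_prod ::
  "('a::{comm_semiring,comm_monoid_mult}) nu_structure \<Rightarrow>
    (('n::finite \<Rightarrow> 'a) \<Rightarrow> 'a) set \<Rightarrow> (('n \<Rightarrow> 'a) \<Rightarrow> 'a) set \<Rightarrow> (('n \<Rightarrow> 'a) \<Rightarrow> 'a) set" where
  "kernel_prod F K L = (\<Union>f\<in>K. \<Union>g\<in>L. nu_class F (\<lambda>a. f a * g a))"

definition const_kernel ::
  "('a::{comm_semiring,comm_monoid_mult}) nu_structure \<Rightarrow> (('n::finite \<Rightarrow> 'a) \<Rightarrow> 'a) set" where
  "const_kernel F = kernel_gen F (range (\<lambda>c a. c))"

definition principal_kernels_const ::
  "('a::{comm_semiring,comm_monoid_mult}) nu_structure \<Rightarrow> (('n::finite \<Rightarrow> 'a) \<Rightarrow> 'a) set set" where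
  "principal_kernels_const F = {kernel_gen F {f} | f. f \<in> rat_funs F} \<inter> Pow (const_kernel F)"

inductive_set lattice_gen ::
  "('a::{comm_semiring,comm_monoid_mult}) nu_structure \<Rightarrow>
    (('n::finite \<Rightarrow> 'a) \<Rightarrow> 'a) set set \<Rightarrow> (('n \<Rightarrow> 'a) \<Rightarrow> 'a) set set"
  for F :: "('a::{comm_semiring,comm_monoid_mult}) nu_structure"
    and \<S> :: "(('n::finite \<Rightarrow> 'a) \<Rightarrow> 'a) set set" where
  base: "K \<in> \<S> \<Longrightarrow> K \<in> lattice_gen F \<S>"
| prod: "\<lbrakk>K \<in> lattice_gen F \<S>; L \<in> lattice_gen F \<S>\<rbrakk> \<Longrightarrow> kernel_prod F K L \<in> lattice_gen F \<S>"
| inter: "\<lbrakk>K \<in> lattice_gen F \<S>; L \<in> lattice_gen F \<S>\<rbrakk> \<Longrightarrow> K \<inter> L \<in> lattice_gen F \<S>"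


section \<open>Corner internal and regular kernels\<close>

definition kernel_roots ::
  "('a::{comm_semiring,comm_monoid_mult}) nu_structure \<Rightarrow> (('n \<Rightarrow> 'a) \<Rightarrow> 'a) \<Rightarrow> ('n \<Rightarrow> 'a) set" where
  "kernel_roots F f = {a. nu_eq F (f a) 1}"

definition ghost_roots ::
  "('a::{comm_semiring,comm_monoid_mult}) nu_structure \<Rightarrow> (('n \<Rightarrow> 'a) \<Rightarrow> 'a) \<Rightarrow> ('n \<Rightarrow> 'a) set" where
  "ghost_roots F p = {a. range a \<subseteq> tangible F \<and> p a \<in> ghost F}"

definition corner_internal ::
  "('a::{comm_semiring,comm_monoid_mult}) nu_structure \<Rightarrow> (('n::finite \<Rightarrow> 'a) \<Rightarrow> 'a) \<Rightarrow> bool" where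
  "corner_internal F f \<longleftrightarrow> (\<exists>h\<in>poly_funs. \<exists>g\<in>tangible_poly_funs F. f = quot_fun F h g \<and>
     ghost_roots F (\<lambda>a. g a + h a) \<subseteq> kernel_roots F f)"

text \<open>The order topology on \<open>\<nu>\<close>-values, pulled back along \<open>\<nu>\<close>; points get the product topology.\<close>

definition nu_topology :: "('a::{comm_semiring,comm_monoid_mult}) nu_structure \<Rightarrow> 'a topology" where
  "nu_topology F = topology_generated_by
     ({UNIV} \<union> range (\<lambda>c. {b. nu_less F c b}) \<union> range (\<lambda>c. {b. nu_less F b c}))"

definition point_topology ::
  "('a::{comm_semiring,comm_monoid_mult}) nu_structure \<Rightarrow> ('n::finite \<Rightarrow> 'a) topology" where
  "point_topology F = product_topology (\<lambda>_. nu_topology F) UNIV"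

definition regular_fun ::
  "('a::{comm_semiring,comm_monoid_mult}) nu_structure \<Rightarrow> (('n::finite \<Rightarrow> 'a) \<Rightarrow> 'a) \<Rightarrow> bool" where
  "regular_fun F f \<longleftrightarrow> (\<exists>h\<in>poly_funs. \<exists>g\<in>tangible_poly_funs F. f = quot_fun F h g \<and>
     (\<forall>a\<in>kernel_roots F f. \<forall>U. openin (point_topology F) U \<and> a \<in> U \<longrightarrow>
        (\<exists>b\<in>U. \<not> nu_eq F (h b) (g b))))"

definition corner_internal_kernels ::
  "('a::{comm_semiring,comm_monoid_mult}) nu_structure \<Rightarrow> (('n::finite \<Rightarrow> 'a) \<Rightarrow> 'a) set set" where
  "corner_internal_kernels F = {kernel_gen F {f} | f. f \<in> rat_funs F \<and> corner_internal F f}"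

definition regular_kernels ::
  "('a::{comm_semiring,comm_monoid_mult}) nu_structure \<Rightarrow> (('n::finite \<Rightarrow> 'a) \<Rightarrow> 'a) set set" where
  "regular_kernels F = {kernel_gen F {f} | f. f \<in> rat_funs F \<and> regular_fun F f}"

end

theory Submission
  imports Defs
begin

text \<open>By bipotence the \<open>\<nu>\<close>-values form a totally ordered abelian group, which is archimedean and hence
  embeds into the reals (Hoelder). Modulo \<open>\<cong>\<^sub>\<nu>\<close>, rational functions become differences of maxima of
  affine functions with natural slopes, principal kernels become principal convex \<open>l\<close>-subgroups, product
  and intersection become \<open>|\<phi>| + |\<psi>|\<close> and \<open>min |\<phi>| |\<psi>|\<close>, and \<open>\<langle>F\<rangle>\<close> consists of the bounded functions.

  A bounded \<open>\<phi> = max\<^sub>i h\<^sub>i - max\<^sub>j g\<^sub>j\<close> vanishes on the union of the polyhedra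
  \<open>h\<^sub>i = g\<^sub>j \<ge> r\<close>, where \<open>r\<close> runs through all monomials. Each polyhedron is cut out by the equation \<open>h\<^sub>i = g\<^sub>j\<close>
  and the corner loci of \<open>h\<^sub>i + g\<^sub>j + r\<close>, and these are zero sets of bounded corner internal functions.
  An explicit estimate shows that \<open>\<phi>\<close> is equivalent to the resulting minimum of sums.

  If \<open>\<phi>\<close> is regular and the value group is dense, a polyhedron with \<open>h\<^sub>i\<close> and \<open>g\<^sub>j\<close> equal as functions is
  replaced by the polyhedra \<open>h\<^sub>i = q \<ge> r\<close> with \<open>q\<close> different from \<open>h\<^sub>i\<close>: since the zero set has empty interior,
  the maximum is always attained by two different functions there. All pieces are then regular. If the value
  group is discrete, regular functions have no zeros and there is only the kernel of a constant.\<close>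

section \<open>The value group embeds into the reals\<close>

locale archimedean_nu_semifield = nu_semifield F
  for F :: "'a::{comm_semiring,comm_monoid_mult} nu_structure" +
  assumes bipotent: "nu_bipotent F" and archimedean: "nu_archimedean F"
begin

section \<open>The total order of values\<close>

abbreviation le (infix "\<preceq>" 50) where "a \<preceq> b \<equiv> nu_le F a b"

text \<open>Expresses the order by addition, so that transitivity, antisymmetry and compatibility
  with products become semiring identities.\<close>

lemma le_iff_add: "a \<preceq> b \<longleftrightarrow> nu F a + nu F b = nu F b"
proof
  assume "a \<preceq> b"
  show "nu F a + nu F b = nu F b"
  proof (cases "nu F a = nu F b")
    case True then show ?thesis using add_same[of "nu F b" "nu F b"] by (simp add: nu_idem)
  next
    case False
    then have "b + a = b" using \<open>a \<preceq> b\<close> add_dominant unfolding nu_le_def by blast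
    then have "nu F b + nu F a = nu F b" using nu_add by metis
    then show ?thesis by (simp add: add.commute)
  qed
next
  assume "nu F a + nu F b = nu F b"
  then show "a \<preceq> b" unfolding nu_le_def by (rule add_imp_ghost_le[OF nu_ghost nu_ghost])
qed

text \<open>Applying \<open>nu\<close> to bipotence leaves only two possible sums, because
  \<open>nu\<close> is idempotent; by \<open>le_iff_add\<close> these are the two
  comparisons.\<close>

lemma le_linear: "a \<preceq> b \<or> b \<preceq> a"
proof -
  have "a + b \<in> {a, b, nu F a}" using bipotent unfolding nu_bipotent_def by blast
  then have "nu F a + nu F b \<in> {nu F a, nu F b}" using nu_add nu_idem by (metis insert_iff empty_iff)
  then show ?thesis by (auto simp: le_iff_add add.commute)
qed

lemma le_antisym: "a \<preceq> b \<Longrightarrow> b \<preceq> a \<Longrightarrow> nu F a = nu F b"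
  by (simp add: le_iff_add add.commute)

lemma le_trans [trans]: "a \<preceq> b \<Longrightarrow> b \<preceq> c \<Longrightarrow> a \<preceq> c"
  unfolding le_iff_add by (metis add.assoc)

lemma le_refl: "a \<preceq> a"
  using le_linear by blast

lemma le_mult_left: "a \<preceq> b \<Longrightarrow> c * a \<preceq> c * b"
  unfolding le_iff_add by (metis nu_mult distrib_left)

lemma le_mult: "a \<preceq> b \<Longrightarrow> c \<preceq> d \<Longrightarrow> a * c \<preceq> b * d"
  using le_mult_left[of c d a] le_mult_left[of a b d] le_trans by (simp add: mult.commute)

lemma le_power: "a \<preceq> b \<Longrightarrow> a ^ n \<preceq> b ^ n"
  by (induction n) (auto intro: le_mult le_refl)

lemma nu_eq_le: "nu F a = nu F b \<Longrightarrow> a \<preceq> b"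
  using le_refl unfolding nu_le_def by metis

section \<open>Inverses up to \<nu> and unbounded powers\<close>

lemma ex_inverse: "\<exists>b. nu F (a * b) = nu F 1"
proof -
  obtain t where "t \<in> tangible F" "nu F t = nu F a"
    using nu_tangible_onto nu_ghost by (metis imageE)
  then show ?thesis using tangible_inverse nu_mult by metis
qed

lemma le_cancel:
  assumes "c * a \<preceq> c * b" shows "a \<preceq> b"
proof -
  obtain d where d: "nu F (c * d) = nu F 1" using ex_inverse by blast
  have *: "nu F (d * (c * x)) = nu F x" for x
    using d nu_mult by (metis mult.assoc mult.commute mult_1)
  show ?thesis using le_mult_left[OF assms, of d] * unfolding nu_le_def by metis
qed

lemma tangible_inv:
  assumes "a \<in> tangible F" shows "tangible_inv F a \<in> tangible F" "a * tangible_inv F a = 1"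
proof -
  have "\<exists>!b. b \<in> tangible F \<and> a * b = 1"
    using tangible_inverse[OF assms] by (metis mult.assoc mult.commute mult_1)
  from theI'[OF this] show "tangible_inv F a \<in> tangible F" "a * tangible_inv F a = 1"
    unfolding tangible_inv_def by auto
qed

text \<open>Outside the tangible elements, \<open>star\<close> comes from the inverse of a chosen
  tangible element of the same \<nu>-value, which also inverts \<open>a\<close> up to \<nu>.\<close>

lemma nu_mult_star: "nu F (a * star F a) = nu F 1"
proof (cases "a \<in> tangible F")
  case True then show ?thesis by (simp add: star_def tangible_inv)
next
  case False
  define t where "t = (SOME t. t \<in> tangible F \<and> nu F t = nu F a)"
  have "\<exists>t. t \<in> tangible F \<and> nu F t = nu F a"
    using nu_tangible_onto nu_ghost by (metis imageE)
  then have t: "t \<in> tangible F" "nu F t = nu F a"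
    using someI_ex unfolding t_def by (metis (mono_tags, lifting))+
  have "star F a = nu F (tangible_inv F t)" using False by (simp add: star_def t_def)
  then show ?thesis using t tangible_inv(2)[OF t(1)] nu_mult nu_idem by metis
qed

text \<open>The archimedean axiom asks for a bound on all integer powers. Since
  \<open>1 \<preceq> t\<close>, the negative powers stay below \<open>t ^ 0\<close>, so a bound on
  the natural powers is a bound on all of them.\<close>

lemma power_unbounded:
  assumes "1 \<preceq> t" "\<not> t \<preceq> 1" shows "\<exists>k. b \<preceq> t ^ k"
proof (rule ccontr)
  assume "\<nexists>k. b \<preceq> t ^ k"
  then have b: "t ^ k \<preceq> b" for k using le_linear by blast
  have "1 * star F t \<preceq> t * star F t" using assms by (intro le_mult le_refl)
  then have "star F t \<preceq> 1" using nu_mult_star unfolding nu_le_def by (metis mult_1)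
  then have "star F t ^ k \<preceq> b" for k using le_power[of _ 1] b[of 0] le_trans by fastforce
  then have "nu_eq F t 1" using archimedean b unfolding nu_archimedean_def int_power_def by metis
  then show False using assms nu_eq_le unfolding nu_eq_def by blast
qed

lemma power_le_power:
  assumes "1 \<preceq> t" "\<not> t \<preceq> 1" "t ^ i \<preceq> t ^ j" shows "i \<le> j"
proof (rule ccontr)
  assume "\<not> i \<le> j"
  then obtain k where k: "i = j + Suc k" using less_imp_Suc_add[of j i] by auto
  have "t ^ j * (t ^ k * t) \<preceq> t ^ j * 1" using assms(3) unfolding k power_add by (simp add: mult.commute)
  then have "t ^ k * t \<preceq> 1" using le_cancel by blast
  moreover have "1 ^ k * t \<preceq> t ^ k * t" using assms by (intro le_mult le_power le_refl)
  ultimately show False using assms(2) le_trans by fastforce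
qed

text \<open>Hoelder's embedding: with \<open>t > 1\<close> fixed, the value of \<open>a\<close> is the cut of the rationals
  \<open>(i - j) / n\<close> with \<open>t\<^sup>i\<^sup>-\<^sup>j \<le> a\<^sup>n\<close>.\<close>

lemma lower_le_upper:
  assumes t: "1 \<preceq> t" "\<not> t \<preceq> 1"
    and "t ^ i \<preceq> a ^ n * t ^ j" "a ^ m * t ^ l \<preceq> t ^ k" "0 < n" "0 < m"
  shows "(real i - real j) / real n \<le> (real k - real l) / real m"
proof -
  have "t ^ (i * m) \<preceq> a ^ (n * m) * t ^ (j * m)"
    using le_power[OF assms(3), of m] by (simp add: power_mult power_mult_distrib)
  moreover have "a ^ (m * n) * t ^ (l * n) \<preceq> t ^ (k * n)"
    using le_power[OF assms(4), of n] by (simp add: power_mult power_mult_distrib)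
  \<comment> \<open>Raised to the common exponent \<open>n * m\<close> and multiplied, the two
    inequalities carry the same power of \<open>a\<close> on both sides, which then cancels.\<close>
  ultimately have "t ^ (i * m) * (a ^ (m * n) * t ^ (l * n)) \<preceq> (a ^ (n * m) * t ^ (j * m)) * t ^ (k * n)"
    by (rule le_mult)
  then have "a ^ (m * n) * t ^ (i * m + l * n) \<preceq> a ^ (m * n) * t ^ (j * m + k * n)"
    by (simp add: power_add ac_simps)
  then have "i * m + l * n \<le> j * m + k * n"
    using le_cancel power_le_power[OF t] by blast
  then have "real i * real m + real l * real n \<le> real j * real m + real k * real n"
    by (metis of_nat_add of_nat_le_iff of_nat_mult)
  then show ?thesis using assms(5,6) by (simp add: field_simps)
qed

text \<open>The supremum of the lower fractions serves: by \<open>lower_le_upper\<close> every upper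
  fraction bounds them.\<close>

lemma ex_cut:
  assumes t: "1 \<preceq> t" "\<not> t \<preceq> 1"
  shows "\<exists>x. (\<forall>i j n. 0 < n \<and> t ^ i \<preceq> a ^ n * t ^ j \<longrightarrow> (real i - real j) / real n \<le> x) \<and>
             (\<forall>i j n. 0 < n \<and> a ^ n * t ^ j \<preceq> t ^ i \<longrightarrow> x \<le> (real i - real j) / real n)"
proof -
  define L where "L = {(real i - real j) / real n | i j n. 0 < n \<and> t ^ i \<preceq> a ^ n * t ^ j}"
  obtain u where "a \<preceq> t ^ u" using power_unbounded[OF t] by blast
  then have u: "a ^ 1 * t ^ 0 \<preceq> t ^ u" by simp
  obtain b where b: "nu F (a * b) = nu F 1" using ex_inverse by blast
  obtain w where "b \<preceq> t ^ w" using power_unbounded[OF t] by blast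
  \<comment> \<open>The inverse \<open>b\<close> of \<open>a\<close> lies below
    \<open>t ^ w\<close>, which yields the lower fraction \<open>- w\<close> and makes
    \<open>L\<close> nonempty.\<close>
  then have "a * b \<preceq> a * t ^ w" by (rule le_mult_left)
  then have w: "t ^ 0 \<preceq> a ^ 1 * t ^ w" using b unfolding nu_le_def by simp
  have "(real 0 - real w) / real 1 \<in> L" unfolding L_def mem_Collect_eq using w
    by (intro exI[of _ 0] exI[of _ w] exI[of _ 1]) simp
  then have ne: "L \<noteq> {}" by blast
  have ub: "x \<le> (real i - real j) / real n" if "x \<in> L" "0 < n" "a ^ n * t ^ j \<preceq> t ^ i" for x i j n
  proof -
    obtain i' j' n' where "x = (real i' - real j') / real n'" "0 < n'" "t ^ i' \<preceq> a ^ n' * t ^ j'"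
      using \<open>x \<in> L\<close> unfolding L_def by blast
    then show ?thesis using lower_le_upper[OF t _ that(3) _ that(2)] by simp
  qed
  have "bdd_above L" using ub[OF _ _ u] by (intro bdd_aboveI) auto
  then show ?thesis
    by (intro exI[of _ "Sup L"] conjI allI impI cSup_upper cSup_least[OF ne] ub)
       (auto simp: L_def)
qed

text \<open>Powers of \<open>t\<close> determine \<open>n * v a\<close> up to an error that does not
  grow with \<open>n\<close>, so additivity and monotonicity follow by taking \<open>n\<close>
  large. That \<open>v\<close> reflects the order uses the archimedean property.\<close>

lemma ex_valuation:
  "\<exists>v :: 'a \<Rightarrow> real. (\<forall>a b. v (a * b) = v a + v b) \<and> (\<forall>a b. nu_le F a b \<longleftrightarrow> v a \<le> v b)"
proof (cases "\<forall>a. a \<preceq> 1")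
  case True
  \<comment> \<open>If nothing exceeds 1, inverses make any two elements comparable both ways, and
    the zero map is a valuation.\<close>
  have "a \<preceq> b" for a b
  proof -
    obtain c where c: "nu F (b * c) = nu F 1" using ex_inverse by blast
    have "c * a \<preceq> c * b" using True c unfolding nu_le_def by (metis mult.commute)
    then show ?thesis by (rule le_cancel)
  qed
  then show ?thesis by (intro exI[of _ "\<lambda>_. 0"]) auto
next
  case False
  then obtain t where t: "1 \<preceq> t" "\<not> t \<preceq> 1" using le_linear by blast
  obtain v where lower: "\<And>a i j n. 0 < n \<Longrightarrow> t ^ i \<preceq> a ^ n * t ^ j \<Longrightarrow> (real i - real j) / real n \<le> v a"
    and upper: "\<And>a i j n. 0 < n \<Longrightarrow> a ^ n * t ^ j \<preceq> t ^ i \<Longrightarrow> v a \<le> (real i - real j) / real n"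
    using ex_cut[OF t] by metis
  have approx: "\<exists>i j. t ^ i \<preceq> a ^ n * t ^ j \<and> a ^ n * t ^ j \<preceq> t ^ (i + 2)" if "0 < n" for a n
  proof -
    \<comment> \<open>Lowering the floor by 1 makes both inequalities around \<open>n * v a\<close>
      strict, as the contrapositives of \<open>lower\<close> and \<open>upper\<close> require.
      \<open>i\<close> and \<open>j\<close> are the positive and negative parts of
      \<open>k\<close>.\<close>
    define k where "k = \<lfloor>real n * v a\<rfloor> - 1"
    define i j where "i = nat k" and "j = nat (- k)"
    have ij: "real i - real j = of_int k" unfolding i_def j_def by (cases "0 \<le> k") auto
    have "of_int k < real n * v a" "real n * v a < of_int k + 2" unfolding k_def by linarith+
    then have "(real i - real j) / real n < v a" "v a < (real (i + 2) - real j) / real n"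
      using ij that by (auto simp: field_simps)
    then have "\<not> a ^ n * t ^ j \<preceq> t ^ i" "\<not> t ^ (i + 2) \<preceq> a ^ n * t ^ j"
      using lower upper that by (meson not_less)+
    then show ?thesis using le_linear by blast
  qed
  have mult: "v (a * b) = v a + v b" for a b
  proof -
    \<comment> \<open>After scaling by \<open>n\<close> the error is at most 4 for every
      \<open>n\<close>, so the error itself vanishes.\<close>
    have "real n * \<bar>v (a * b) - (v a + v b)\<bar> \<le> 4" if n: "0 < n" for n
    proof -
      obtain i j where a: "t ^ i \<preceq> a ^ n * t ^ j" "a ^ n * t ^ j \<preceq> t ^ (i + 2)"
        using approx[OF n] by blast
      obtain k l where b: "t ^ k \<preceq> b ^ n * t ^ l" "b ^ n * t ^ l \<preceq> t ^ (k + 2)"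
        using approx[OF n] by blast
      have "t ^ (i + k) \<preceq> (a * b) ^ n * t ^ (j + l)" "(a * b) ^ n * t ^ (j + l) \<preceq> t ^ (i + k + 4)"
        using le_mult[OF a(1) b(1)] le_mult[OF a(2) b(2)]
        by (auto simp: power_add power_mult_distrib ac_simps numeral_eq_Suc)
      from lower[OF n this(1)] upper[OF n this(2)] lower[OF n a(1)] lower[OF n b(1)]
        upper[OF n a(2)] upper[OF n b(2)]
      have *: "real (i+k) - real (j+l) \<le> real n * v (a * b)"
        "real n * v (a * b) \<le> real (i+k+4) - real (j+l)"
        "real i - real j \<le> real n * v a" "real n * v a \<le> real (i + 2) - real j"
        "real k - real l \<le> real n * v b" "real n * v b \<le> real (k + 2) - real l"
        using n by (auto simp: field_simps)
      have "\<bar>real n * v (a * b) - (real n * v a + real n * v b)\<bar> \<le> 4"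
        unfolding abs_le_iff using * by auto
      moreover have "real n * \<bar>v (a * b) - (v a + v b)\<bar> = \<bar>real n * v (a * b) - (real n * v a + real n * v b)\<bar>"
        using abs_mult[of "real n" "v (a * b) - (v a + v b)"] by (simp add: algebra_simps)
      ultimately show ?thesis by simp
    qed
    then have "\<bar>v (a * b) - (v a + v b)\<bar> \<le> 0"
      using real_archimedian_rdiv_eq_0[of "\<bar>v (a * b) - (v a + v b)\<bar>" 4] by auto
    then show ?thesis by simp
  qed
  have mono: "v a \<le> v b" if "a \<preceq> b" for a b
  proof (rule ccontr)
    assume "\<not> v a \<le> v b"
    then have "v b < v a" by simp
    then obtain n where n: "0 < n" "2 < real n * (v a - v b)"
      using reals_Archimedean3[of "v a - v b"]
      by (metis diff_gt_0_iff_gt mult_zero_left not_gr_zero of_nat_0 zero_less_numeral order.asym)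
    obtain i j where "t ^ i \<preceq> a ^ n * t ^ j" "a ^ n * t ^ j \<preceq> t ^ (i + 2)" using approx[OF n(1)] by blast
    moreover from this have "t ^ i \<preceq> b ^ n * t ^ j" using le_mult[OF le_power[OF that] le_refl] le_trans by blast
    ultimately have "v a \<le> (real (i + 2) - real j) / real n" "(real i - real j) / real n \<le> v b"
      using lower upper n(1) by blast+
    then show False using n by (auto simp: field_simps)
  qed
  have strict: "a \<preceq> b" if "v a \<le> v b" for a b
  proof (rule ccontr)
    assume nle: "\<not> a \<preceq> b"
    obtain d where d: "nu F (b * d) = nu F 1" using ex_inverse by blast
    have eq: "v x = v y" if "nu F x = nu F y" for x y
      using mono nu_eq_le that by (metis order_antisym)
    have "\<not> d * a \<preceq> d * b" using nle le_cancel by blast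
    then have "\<not> d * a \<preceq> 1" using d nu_eq_le le_trans by (metis mult.commute)
    \<comment> \<open>Since \<open>d * a\<close> exceeds 1, some power of it passes
      \<open>t\<close>; this bounds its value below by \<open>1 / k\<close> and separates
      \<open>v a\<close> from \<open>v b\<close>.\<close>
    then obtain k where k: "t \<preceq> (d * a) ^ k" using power_unbounded[of "d * a"] le_linear by blast
    then have "k \<noteq> 0" using t(2) by (metis power_0)
    then have "1 / real k \<le> v (d * a)" using lower[of k 1 "d * a" 0] k by auto
    moreover have "v b + v d = v 1" "v 1 = 0" using eq[OF d] mult[of b d] mult[of 1 1] by auto
    ultimately have "1 / real k \<le> v a - v b" using mult by simp
    then show False using \<open>k \<noteq> 0\<close> that by (smt (verit) of_nat_0_less_iff not_gr_zero zero_less_divide_1_iff)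
  qed
  show ?thesis using mult mono strict by blast
qed

end

section \<open>Rational functions as piecewise linear functions\<close>

locale valued_nu_semifield = archimedean_nu_semifield F
  for F :: "'a::{comm_semiring,comm_monoid_mult} nu_structure" +
  fixes val :: "'a \<Rightarrow> real"
  assumes val_mult: "val (a * b) = val a + val b" and nu_le_val: "nu_le F a b \<longleftrightarrow> val a \<le> val b"
begin

section \<open>Values of sums, products and inverses\<close>

lemma nu_val: "nu F a = nu F b \<longleftrightarrow> val a = val b"
  using nu_eq_le le_antisym nu_le_val by (metis order_antisym order_refl)

lemma nu_eq_val: "nu_eq F a b \<longleftrightarrow> val a = val b"
  unfolding nu_eq_def nu_val ..

lemma nu_less_val: "nu_less F a b \<longleftrightarrow> val a < val b"
  unfolding nu_less_def nu_eq_val nu_le_val by auto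

lemma val_one [simp]: "val 1 = 0"
  using val_mult[of 1 1] by simp

lemma add_eq_left: "val b < val a \<Longrightarrow> a + b = a"
  using add_dominant nu_le_val nu_val unfolding nu_le_def by (metis less_eq_real_def less_irrefl)

lemma val_add: "val (a + b) = max (val a) (val b)"
proof (cases "val a" "val b" rule: linorder_cases)
  case less then show ?thesis using add_eq_left[of a b] by (simp add: add.commute)
next
  case equal
  then have "nu F (a + b) = nu F a" using add_same nu_val nu_idem by metis
  then show ?thesis using equal nu_val by simp
next
  case greater then show ?thesis using add_eq_left[of b a] by simp
qed

lemma val_star: "val (star F a) = - val a"
proof -
  have "val (a * star F a) = val 1" using nu_mult_star nu_val by blast
  then show ?thesis by (simp add: val_mult)
qed

lemma val_power: "val (a ^ n) = real n * val a"
  by (induction n) (auto simp: val_mult algebra_simps)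

lemma val_prod: "finite A \<Longrightarrow> val (\<Prod>i\<in>A. f i) = (\<Sum>i\<in>A. val (f i))"
  by (induction A rule: finite_induct) (auto simp: val_mult)

lemma ex_tangible_val: "\<exists>t\<in>tangible F. val t = val a"
  using nu_tangible_onto nu_ghost nu_val by (metis imageE)

lemma tangible_power: "a \<in> tangible F \<Longrightarrow> a ^ n \<in> tangible F"
  by (induction n) (auto intro: tangible_mult tangible_one)

lemma tangible_prod: "finite A \<Longrightarrow> (\<And>i. i \<in> A \<Longrightarrow> f i \<in> tangible F) \<Longrightarrow> (\<Prod>i\<in>A. f i) \<in> tangible F"
  by (induction A rule: finite_induct) (auto intro: tangible_mult tangible_one)

lemma star_one: "star F 1 = 1"
  using tangible_inv(2)[OF tangible_one] tangible_one by (simp add: star_def)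

section \<open>Monomials as affine functions, polynomials as their maxima\<close>

definition mono_val :: "'a \<times> ('n::finite \<Rightarrow> nat) \<Rightarrow> ('n \<Rightarrow> 'a) \<Rightarrow> real" where
  "mono_val m a = val (fst m) + (\<Sum>i\<in>UNIV. real (snd m i) * val (a i))"

text \<open>A set may contain several monomials with the same exponent vector, so unions and
  products need no collecting of terms.\<close>

definition poly_val :: "('a \<times> ('n::finite \<Rightarrow> nat)) set \<Rightarrow> ('n \<Rightarrow> 'a) \<Rightarrow> real" where
  "poly_val S a = Max ((\<lambda>m. mono_val m a) ` S)"

definition mono_mult :: "'a \<times> ('n::finite \<Rightarrow> nat) \<Rightarrow> 'a \<times> ('n \<Rightarrow> nat) \<Rightarrow> 'a \<times> ('n \<Rightarrow> nat)" where
  "mono_mult p q = (fst p * fst q, \<lambda>i. snd p i + snd q i)"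

lemma mono_val_mult: "mono_val (mono_mult p q) a = mono_val p a + mono_val q a"
  unfolding mono_val_def mono_mult_def by (simp add: val_mult distrib_right sum.distrib)

lemma mono_val_const: "mono_val (c, \<lambda>_. 0) a = val c"
  unfolding mono_val_def by simp

lemma poly_val_ge: "finite S \<Longrightarrow> m \<in> S \<Longrightarrow> mono_val m a \<le> poly_val S a"
  unfolding poly_val_def by simp

lemma poly_val_attained:
  assumes "finite S" "S \<noteq> {}" obtains m where "m \<in> S" "mono_val m a = poly_val S a"
  using Max_in[of "(\<lambda>m. mono_val m a) ` S"] assms unfolding poly_val_def by fastforce

lemma poly_val_eqI:
  "finite S \<Longrightarrow> m \<in> S \<Longrightarrow> (\<And>m'. m' \<in> S \<Longrightarrow> mono_val m' a \<le> mono_val m a) \<Longrightarrow> poly_val S a = mono_val m a"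
  unfolding poly_val_def by (auto intro!: Max_eqI)

lemma poly_val_singleton [simp]: "poly_val {m} a = mono_val m a"
  unfolding poly_val_def by simp

lemma poly_val_insert:
  "finite S \<Longrightarrow> S \<noteq> {} \<Longrightarrow> poly_val (insert m S) a = max (mono_val m a) (poly_val S a)"
  unfolding poly_val_def by simp

lemma poly_val_Un:
  "finite S \<Longrightarrow> S \<noteq> {} \<Longrightarrow> finite T \<Longrightarrow> T \<noteq> {} \<Longrightarrow>
    poly_val (S \<union> T) a = max (poly_val S a) (poly_val T a)"
  unfolding poly_val_def by (simp add: image_Un Max_Un)

definition poly_mult where "poly_mult S T = (\<lambda>(p, q). mono_mult p q) ` (S \<times> T)"

lemma poly_mult_finite: "finite S \<Longrightarrow> finite T \<Longrightarrow> finite (poly_mult S T)"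
  unfolding poly_mult_def by simp

lemma poly_mult_nonempty: "S \<noteq> {} \<Longrightarrow> T \<noteq> {} \<Longrightarrow> poly_mult S T \<noteq> {}"
  unfolding poly_mult_def by simp

text \<open>The product of two maximal monomials is maximal among all products.\<close>

lemma poly_val_mult:
  assumes "finite S" "S \<noteq> {}" "finite T" "T \<noteq> {}"
  shows "poly_val (poly_mult S T) a = poly_val S a + poly_val T a"
proof -
  obtain p where p: "p \<in> S" "mono_val p a = poly_val S a" using poly_val_attained assms by metis
  obtain q where q: "q \<in> T" "mono_val q a = poly_val T a" using poly_val_attained assms by metis
  have "poly_val (poly_mult S T) a = mono_val (mono_mult p q) a"
  proof (rule poly_val_eqI)
    show "finite (poly_mult S T)" using assms by (simp add: poly_mult_finite)
    show "mono_mult p q \<in> poly_mult S T" using p q unfolding poly_mult_def by auto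
    fix m assume "m \<in> poly_mult S T"
    then obtain p' q' where "m = mono_mult p' q'" "p' \<in> S" "q' \<in> T" unfolding poly_mult_def by auto
    then show "mono_val m a \<le> mono_val (mono_mult p q) a"
      using poly_val_ge assms p q by (metis mono_val_mult add_mono)
  qed
  then show ?thesis using p q by (simp add: mono_val_mult)
qed

section \<open>From formal sums to polynomial functions\<close>

definition monomial_eval :: "('n::finite \<Rightarrow> 'a) \<Rightarrow> 'a \<times> ('n \<Rightarrow> nat) \<Rightarrow> 'a" where
  "monomial_eval a m = fst m * (\<Prod>i\<in>UNIV. a i ^ snd m i)"

lemma poly_eval_monomials: "poly_eval ms a = sum_nonempty (map (monomial_eval a) ms)"
  unfolding poly_eval_def monomial_eval_def by (simp add: case_prod_unfold)

lemma val_monomial: "val (monomial_eval a m) = mono_val m a"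
  unfolding monomial_eval_def mono_val_def by (simp add: val_mult val_prod val_power)

lemma val_sum_nonempty: "xs \<noteq> [] \<Longrightarrow> val (sum_nonempty xs) = Max (val ` set xs)"
proof (induction xs rule: sum_nonempty.induct)
  case (2 x y xs)
  then have "val (sum_nonempty (x # y # xs)) = max (val x) (Max (val ` set (y # xs)))"
    by (simp add: val_add)
  then show ?case by (simp del: sum_nonempty.simps)
qed auto

lemma val_poly_eval: "ms \<noteq> [] \<Longrightarrow> val (poly_eval ms a) = poly_val (set ms) a"
  unfolding poly_eval_monomials poly_val_def
  by (simp add: val_sum_nonempty image_image val_monomial)

text \<open>A strictly dominant term absorbs the others exactly and not just up to \<nu>. This is
  what makes a polynomial value tangible where one monomial dominates.\<close>

lemma sum_nonempty_dominant:
  "m \<in> set ms \<Longrightarrow> distinct ms \<Longrightarrow> (\<And>m'. m' \<in> set ms \<Longrightarrow> m' \<noteq> m \<Longrightarrow> val (f m') < val (f m)) \<Longrightarrow>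
    sum_nonempty (map f ms) = f m"
proof (induction ms rule: induct_list012)
  case (3 x y zs)
  show ?case
  proof (cases "m = x")
    case True
    have "val (sum_nonempty (map f (y # zs))) = Max (val ` set (map f (y # zs)))"
      by (rule val_sum_nonempty) simp
    also have "\<dots> \<in> val ` set (map f (y # zs))" by (rule Max_in) auto
    finally obtain z where z: "z \<in> set (y # zs)" "val (sum_nonempty (map f (y # zs))) = val (f z)"
      by auto
    moreover have "z \<noteq> m" using z(1) True 3(4) by auto
    ultimately have "val (sum_nonempty (map f (y # zs))) < val (f m)" using 3(5)[of z] by simp
    then show ?thesis using True add_eq_left by simp
  next
    case False
    then have "sum_nonempty (map f (y # zs)) = f m" using 3 by auto
    moreover have "val (f x) < val (f m)" using False 3 by auto
    ultimately show ?thesis using add_eq_left by (metis add.commute list.simps(9) sum_nonempty.simps(2))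
  qed
qed auto

text \<open>Among the monomials with the same exponent, keep one tangible coefficient of maximal value. A
  formal sum could have ghost coefficients instead.\<close>

lemma tangible_realization:
  fixes S :: "('a \<times> ('n::finite \<Rightarrow> nat)) set"
  assumes "finite S" "S \<noteq> {}"
  obtains f where "f \<in> tangible_poly_funs F" "\<And>a. val (f a) = poly_val S a"
    "\<And>a m. range a \<subseteq> tangible F \<Longrightarrow> m \<in> S \<Longrightarrow> (\<And>m'. m' \<in> S \<Longrightarrow> m' \<noteq> m \<Longrightarrow> mono_val m' a < mono_val m a) \<Longrightarrow>
      f a \<in> tangible F"
proof -
  have "\<exists>t. t \<in> tangible F \<and> (\<exists>m\<in>S. snd m = e \<and> val (fst m) = val t) \<and>
      (\<forall>m\<in>S. snd m = e \<longrightarrow> val (fst m) \<le> val t)" if "e \<in> snd ` S" for e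
  proof -
    let ?A = "val ` fst ` {m \<in> S. snd m = e}"
    have "Max ?A \<in> ?A" using that assms by (intro Max_in) auto
    then obtain m where m: "m \<in> S" "snd m = e" "val (fst m) = Max ?A" by auto
    moreover have "val (fst m') \<le> val (fst m)" if "m' \<in> S" "snd m' = e" for m'
      unfolding m(3) using that assms by (intro Max_ge) auto
    moreover obtain t where "t \<in> tangible F" "val t = val (fst m)" using ex_tangible_val by blast
    ultimately show ?thesis by metis
  qed
  then obtain c where c: "\<And>e. e \<in> snd ` S \<Longrightarrow> c e \<in> tangible F"
    "\<And>e. e \<in> snd ` S \<Longrightarrow> \<exists>m\<in>S. snd m = e \<and> val (fst m) = val (c e)"
    "\<And>m. m \<in> S \<Longrightarrow> val (fst m) \<le> val (c (snd m))" by (metis imageI)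
  obtain es where es: "set es = snd ` S" "distinct es"
    using finite_distinct_list assms(1) by (metis finite_imageI)
  define ms where "ms = map (\<lambda>e. (c e, e)) es"
  have ms: "ms \<noteq> []" using es assms unfolding ms_def by auto
  have dist: "distinct (map snd ms)" using es unfolding ms_def by (simp add: o_def)
  have up: "\<exists>m'\<in>set ms. snd m' = snd m \<and> mono_val m a \<le> mono_val m' a" if "m \<in> S" for m a
    using c(3)[OF that] that es unfolding ms_def mono_val_def by auto
  have down: "\<exists>m\<in>S. snd m = snd m' \<and> mono_val m a = mono_val m' a" if "m' \<in> set ms" for m' a
  proof -
    from that obtain e where e: "e \<in> snd ` S" "m' = (c e, e)" using es unfolding ms_def by auto
    then obtain m where "m \<in> S" "snd m = e" "val (fst m) = val (c e)" using c(2) by blast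
    then show ?thesis using e by (intro bexI[of _ m]) (auto simp: mono_val_def)
  qed
  show ?thesis
  proof
    show "poly_eval ms \<in> tangible_poly_funs F"
      unfolding tangible_poly_funs_def using ms dist c(1) es
      by (intro CollectI exI[of _ ms]) (auto simp: ms_def image_image)
    show "val (poly_eval ms a) = poly_val S a" for a
    proof -
      obtain m where m: "m \<in> S" "mono_val m a = poly_val S a" using poly_val_attained assms by metis
      obtain m' where m': "m' \<in> set ms" "mono_val m a \<le> mono_val m' a" using up[OF m(1)] by blast
      have le: "x \<in> set ms \<Longrightarrow> mono_val x a \<le> poly_val S a" for x
        using down[of x a] poly_val_ge[OF assms(1)] by metis
      then have eq: "mono_val m' a = mono_val m a" using m(2) m' by (metis order_antisym)
      have "poly_val (set ms) a = mono_val m' a"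
        by (rule poly_val_eqI) (use m' m le eq in auto)
      then show ?thesis using val_poly_eval[OF ms] m eq by simp
    qed
    fix a m assume a: "range a \<subseteq> tangible F" and m: "m \<in> S"
      and uniq: "\<And>m'. m' \<in> S \<Longrightarrow> m' \<noteq> m \<Longrightarrow> mono_val m' a < mono_val m a"
    obtain m' where m': "m' \<in> set ms" "snd m' = snd m" "mono_val m a \<le> mono_val m' a" using up[OF m] by blast
    \<comment> \<open>Strict dominance passes from \<open>S\<close> to \<open>ms\<close>: a
      competitor \<open>x\<close> has the value of some \<open>y\<close> in \<open>S\<close> with
      the same exponent, and \<open>y\<close> is not \<open>m\<close> because exponents in
      \<open>ms\<close> are distinct.\<close>
    have "mono_val x a < mono_val m' a" if "x \<in> set ms" "x \<noteq> m'" for x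
    proof -
      obtain y where y: "y \<in> S" "snd y = snd x" "mono_val y a = mono_val x a" using down \<open>x \<in> set ms\<close> by blast
      have "snd x \<noteq> snd m'" using that m'(1) unfolding ms_def by auto
      then have "y \<noteq> m" using y m' by auto
      then have "mono_val y a < mono_val m a" using uniq y by blast
      then show ?thesis using y m' by simp
    qed
    then have "poly_eval ms a = monomial_eval a m'"
      unfolding poly_eval_monomials using dist
      by (intro sum_nonempty_dominant m'(1)) (auto simp: val_monomial distinct_map)
    moreover obtain e where "e \<in> snd ` S" "m' = (c e, e)" using m'(1) es unfolding ms_def by auto
    then have "fst m' \<in> tangible F" using c(1) by simp
    ultimately show "poly_eval ms a \<in> tangible F" unfolding monomial_eval_def
      using a by (auto intro!: tangible_mult tangible_prod tangible_power)
  qed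
qed

lemma tangible_poly_funs_subset: "tangible_poly_funs F \<subseteq> poly_funs"
  unfolding tangible_poly_funs_def poly_funs_def by blast

lemma poly_funs_val:
  assumes "f \<in> poly_funs"
  obtains S where "finite S" "S \<noteq> {}" "\<And>a. val (f a) = poly_val S a"
proof -
  obtain ms where "ms \<noteq> []" "f = poly_eval ms" using assms unfolding poly_funs_def by blast
  then show ?thesis using that[of "set ms"] val_poly_eval by auto
qed

lemma val_quot_fun: "val (quot_fun F h g a) = val (h a) - val (g a)"
  unfolding quot_fun_def by (simp add: val_mult val_star)

section \<open>The lattice-ordered group of value functions\<close>

definition rat_vals :: "(('n::finite \<Rightarrow> 'a) \<Rightarrow> real) set" where
  "rat_vals = {\<lambda>a. val (f a) | f. f \<in> rat_funs F}"

lemma rat_valsE: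
  assumes "\<phi> \<in> rat_vals"
  obtains S T where "finite S" "S \<noteq> {}" "finite T" "T \<noteq> {}" "\<phi> = (\<lambda>a. poly_val S a - poly_val T a)"
proof -
  obtain h g where hg: "h \<in> poly_funs" "g \<in> tangible_poly_funs F" "\<phi> = (\<lambda>a. val (quot_fun F h g a))"
    using assms unfolding rat_vals_def rat_funs_def by blast
  obtain S where S: "finite S" "S \<noteq> {}" "\<And>a. val (h a) = poly_val S a" using poly_funs_val hg by blast
  obtain T where T: "finite T" "T \<noteq> {}" "\<And>a. val (g a) = poly_val T a"
    using poly_funs_val hg tangible_poly_funs_subset by blast
  show ?thesis using that S T hg(3) by (simp add: val_quot_fun)
qed

lemma rat_valsI:
  assumes "finite S" "S \<noteq> {}" "finite T" "T \<noteq> {}"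
  shows "(\<lambda>a. poly_val S a - poly_val T a) \<in> rat_vals"
proof -
  obtain h where h: "h \<in> tangible_poly_funs F" "\<And>a. val (h a) = poly_val S a"
    using tangible_realization[OF assms(1,2)] by metis
  obtain g where g: "g \<in> tangible_poly_funs F" "\<And>a. val (g a) = poly_val T a"
    using tangible_realization[OF assms(3,4)] by metis
  have "quot_fun F h g \<in> rat_funs F" using h g tangible_poly_funs_subset unfolding rat_funs_def by blast
  moreover have "(\<lambda>a. poly_val S a - poly_val T a) = (\<lambda>a. val (quot_fun F h g a))"
    by (simp add: val_quot_fun h g)
  ultimately show ?thesis unfolding rat_vals_def by blast
qed

lemma rat_vals_uminus: "\<phi> \<in> rat_vals \<Longrightarrow> (\<lambda>a. - \<phi> a) \<in> rat_vals"
  by (erule rat_valsE) (simp add: rat_valsI)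

lemma rat_vals_add:
  assumes "\<phi> \<in> rat_vals" "\<psi> \<in> rat_vals" shows "(\<lambda>a. \<phi> a + \<psi> a) \<in> rat_vals"
proof -
  obtain S T where S: "finite S" "S \<noteq> {}" "finite T" "T \<noteq> {}" "\<phi> = (\<lambda>a. poly_val S a - poly_val T a)"
    using rat_valsE[OF assms(1)] .
  obtain U V where U: "finite U" "U \<noteq> {}" "finite V" "V \<noteq> {}" "\<psi> = (\<lambda>a. poly_val U a - poly_val V a)"
    using rat_valsE[OF assms(2)] .
  have "(\<lambda>a. \<phi> a + \<psi> a) = (\<lambda>a. poly_val (poly_mult S U) a - poly_val (poly_mult T V) a)"
    using S U by (simp add: poly_val_mult fun_eq_iff)
  then show ?thesis using S U by (simp add: rat_valsI poly_mult_finite poly_mult_nonempty)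
qed

text \<open>Both differences are brought to the common denominator
  \<open>poly_mult T V\<close>.\<close>

lemma rat_vals_max:
  assumes "\<phi> \<in> rat_vals" "\<psi> \<in> rat_vals" shows "(\<lambda>a. max (\<phi> a) (\<psi> a)) \<in> rat_vals"
proof -
  obtain S T where S: "finite S" "S \<noteq> {}" "finite T" "T \<noteq> {}" "\<phi> = (\<lambda>a. poly_val S a - poly_val T a)"
    using rat_valsE[OF assms(1)] .
  obtain U V where U: "finite U" "U \<noteq> {}" "finite V" "V \<noteq> {}" "\<psi> = (\<lambda>a. poly_val U a - poly_val V a)"
    using rat_valsE[OF assms(2)] .
  have "(\<lambda>a. max (\<phi> a) (\<psi> a)) =
      (\<lambda>a. poly_val (poly_mult S V \<union> poly_mult U T) a - poly_val (poly_mult T V) a)"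
    using S U by (auto simp: poly_val_mult poly_val_Un poly_mult_finite poly_mult_nonempty fun_eq_iff)
  then show ?thesis using S U by (simp add: rat_valsI poly_mult_finite poly_mult_nonempty)
qed

lemma rat_vals_diff: "\<phi> \<in> rat_vals \<Longrightarrow> \<psi> \<in> rat_vals \<Longrightarrow> (\<lambda>a. \<phi> a - \<psi> a) \<in> rat_vals"
  using rat_vals_add[OF _ rat_vals_uminus] by fastforce

lemma rat_vals_min:
  assumes "\<phi> \<in> rat_vals" "\<psi> \<in> rat_vals" shows "(\<lambda>a. min (\<phi> a) (\<psi> a)) \<in> rat_vals"
  using rat_vals_uminus[OF rat_vals_max[OF rat_vals_uminus rat_vals_uminus], OF assms]
  by (simp add: minus_max_eq_min)

lemma abs_eq_max: "\<bar>x\<bar> = max x (- x)" for x :: real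
  by simp

lemma rat_vals_abs: "\<phi> \<in> rat_vals \<Longrightarrow> (\<lambda>a. \<bar>\<phi> a\<bar>) \<in> rat_vals"
  using rat_vals_max[OF _ rat_vals_uminus, of \<phi> \<phi>] by (simp add: abs_eq_max)

lemma const_in_rat_funs: "(\<lambda>_ :: 'n::finite \<Rightarrow> 'a. c) \<in> rat_funs F"
proof -
  define e where "e = (\<lambda>c::'a. [(c, \<lambda>_::'n. 0::nat)])"
  have e: "poly_eval (e c) = (\<lambda>_. c)" for c unfolding poly_eval_def e_def by auto
  have "poly_eval (e c) \<in> poly_funs" unfolding poly_funs_def by (auto simp: e_def)
  moreover have "poly_eval (e 1) \<in> tangible_poly_funs F"
    unfolding tangible_poly_funs_def by (auto simp: e_def tangible_one)
  ultimately have "quot_fun F (poly_eval (e c)) (poly_eval (e 1)) \<in> rat_funs F" unfolding rat_funs_def by blast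
  then show ?thesis by (simp add: quot_fun_def e star_one)
qed

lemma rat_vals_const: "(\<lambda>_. val c) \<in> rat_vals"
  unfolding rat_vals_def using const_in_rat_funs[of c] by (auto intro!: exI[of _ "\<lambda>_. c"])

lemma rat_vals_cmult: "\<phi> \<in> rat_vals \<Longrightarrow> (\<lambda>a. real k * \<phi> a) \<in> rat_vals"
proof (induction k)
  case 0 then show ?case using rat_vals_const[of 1] by simp
next
  case (Suc k) then show ?case using rat_vals_add[of \<phi> "\<lambda>a. real k * \<phi> a"] by (simp add: distrib_right)
qed

lemma mono_val_in_rat_vals: "mono_val p \<in> rat_vals"
  using rat_valsI[of "{p}" "{(1, \<lambda>_. 0)}"] by (simp add: mono_val_const)

subsection \<open>Kernels\<close>

lemma rat_vals_iff: "\<phi> \<in> rat_vals \<longleftrightarrow> (\<exists>f\<in>rat_funs F. \<phi> = (\<lambda>a. val (f a)))"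
  unfolding rat_vals_def by blast

lemma rat_funs_val: "f \<in> rat_funs F \<Longrightarrow> (\<lambda>a. val (f a)) \<in> rat_vals"
  unfolding rat_vals_def by blast

lemma nu_class_val: "nu_class F \<phi> = {c \<in> rat_funs F. \<forall>a. val (c a) = val (\<phi> a)}"
  unfolding nu_class_def nu_eq_fun_def nu_eq_val ..

lemma nu_kernel_rat: "nu_kernel F K \<Longrightarrow> K \<subseteq> rat_funs F"
  unfolding nu_kernel_def by blast

lemma nu_kernel_mult:
  assumes "nu_kernel F K" "f \<in> K" "g \<in> K" "c \<in> rat_funs F" "\<And>a. val (c a) = val (f a) + val (g a)"
  shows "c \<in> K"
proof -
  have "nu_class F (\<lambda>a. f a * g a) \<subseteq> K" using assms(1-3) unfolding nu_kernel_def by blast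
  then show ?thesis using assms(4,5) unfolding nu_class_val by (auto simp: val_mult)
qed

lemma nu_kernel_star:
  assumes "nu_kernel F K" "f \<in> K" "c \<in> rat_funs F" "\<And>a. val (c a) = - val (f a)"
  shows "c \<in> K"
proof -
  have "nu_class F (\<lambda>a. star F (f a)) \<subseteq> K" using assms(1,2) unfolding nu_kernel_def by blast
  then show ?thesis using assms(3,4) unfolding nu_class_val by (auto simp: val_star)
qed

lemma nu_kernel_combine:
  assumes K: "nu_kernel F K" and fg: "f \<in> K" "g \<in> K"
    and ab: "\<alpha> \<in> rat_funs F" "\<beta> \<in> rat_funs F" "\<And>a. max (val (\<alpha> a)) (val (\<beta> a)) = 0"
    and c: "c \<in> rat_funs F" "\<And>a. val (c a) = max (val (\<alpha> a) + val (f a)) (val (\<beta> a) + val (g a))"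
  shows "c \<in> K"
proof -
  have "nu_eq_fun F (\<lambda>a. \<alpha> a + \<beta> a) (\<lambda>a. 1)"
    unfolding nu_eq_fun_def nu_eq_val by (simp add: val_add ab)
  then have "nu_class F (\<lambda>a. \<alpha> a * f a + \<beta> a * g a) \<subseteq> K"
    using K fg ab unfolding nu_kernel_def by blast
  then show ?thesis using c unfolding nu_class_val by (auto simp: val_mult val_add)
qed

text \<open>The kernel contains \<open>u\<close> of value \<open>\<bar>f\<bar>\<close>, the sum of
  \<open>f\<close> and its inverse with coefficients 1. Then \<open>g\<close> is a combination of
  \<open>u\<close> and its inverse with coefficients \<open>g / u\<close> and 1: as
  \<open>\<bar>g\<bar> \<le> u\<close>, the coefficients add up to 1 and the second term never
  exceeds the first.\<close>

lemma nu_kernel_convex: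
  assumes K: "nu_kernel F K" and f: "f \<in> K" and g: "g \<in> rat_funs F"
    and le: "\<And>a. \<bar>val (g a)\<bar> \<le> \<bar>val (f a)\<bar>"
  shows "g \<in> K"
proof -
  have V: "(\<lambda>a. val (f a)) \<in> rat_vals" "(\<lambda>a. val (g a)) \<in> rat_vals"
    using f g nu_kernel_rat[OF K] rat_funs_val by auto
  obtain f' where f': "f' \<in> rat_funs F" "\<And>a. val (f' a) = - val (f a)"
    using rat_vals_uminus[OF V(1)] unfolding rat_vals_iff by metis
  then have f'K: "f' \<in> K" using nu_kernel_star[OF K f] by blast
  obtain u where u: "u \<in> rat_funs F" "\<And>a. val (u a) = \<bar>val (f a)\<bar>"
    using rat_vals_abs[OF V(1)] unfolding rat_vals_iff by metis
  have uK: "u \<in> K"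
    by (rule nu_kernel_combine[OF K f f'K const_in_rat_funs[of 1] const_in_rat_funs[of 1] _ u(1)])
       (auto simp: u f')
  obtain u' where u': "u' \<in> rat_funs F" "\<And>a. val (u' a) = - val (u a)"
    using rat_vals_uminus[OF rat_funs_val[OF u(1)]] unfolding rat_vals_iff by metis
  then have u'K: "u' \<in> K" using nu_kernel_star[OF K uK] by blast
  obtain \<alpha> where \<alpha>: "\<alpha> \<in> rat_funs F" "\<And>a. val (\<alpha> a) = val (g a) - val (u a)"
    using rat_vals_diff[OF V(2) rat_funs_val[OF u(1)]] unfolding rat_vals_iff by metis
  have bounds: "val (g a) \<le> val (u a)" "- val (u a) \<le> val (g a)" for a
    using le[of a] u(2)[of a] by auto
  show ?thesis
    by (rule nu_kernel_combine[OF K uK u'K \<alpha>(1) const_in_rat_funs[of 1] _ g])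
       (use bounds in \<open>auto simp: u' \<alpha>\<close>)
qed

text \<open>The kernel generated by any rational function with values \<open>\<phi>\<close>, in additive notation.\<close>

definition ideal :: "(('n::finite \<Rightarrow> 'a) \<Rightarrow> real) \<Rightarrow> (('n \<Rightarrow> 'a) \<Rightarrow> 'a) set" where
  "ideal \<phi> = {g \<in> rat_funs F. \<exists>k::nat. \<forall>a. \<bar>val (g a)\<bar> \<le> real k * \<bar>\<phi> a\<bar>}"

lemma idealI: "g \<in> rat_funs F \<Longrightarrow> (\<And>a. \<bar>val (g a)\<bar> \<le> real k * \<bar>\<phi> a\<bar>) \<Longrightarrow> g \<in> ideal \<phi>"
  unfolding ideal_def by blast

text \<open>For coefficients with \<open>max \<alpha> \<beta> = 0\<close> both are at most 0 and one
  of them is 0 at each point, so the combination is bounded by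
  \<open>\<bar>\<phi>\<bar> + \<bar>\<psi>\<bar>\<close>. Closure under sums and under smaller
  absolute values therefore covers the last kernel condition.\<close>

lemma nu_kernelI:
  fixes K :: "(('n::finite \<Rightarrow> 'a) \<Rightarrow> 'a) set"
  assumes "K = {f \<in> rat_funs F. P (\<lambda>a. val (f a))}" and "P (\<lambda>_. 0)"
    and add: "\<And>\<phi> \<psi>. P \<phi> \<Longrightarrow> P \<psi> \<Longrightarrow> P (\<lambda>a. \<phi> a + \<psi> a)"
    and uminus: "\<And>\<phi>. P \<phi> \<Longrightarrow> P (\<lambda>a. - \<phi> a)"
    and mono: "\<And>\<phi> \<psi>. P \<phi> \<Longrightarrow> (\<And>a. \<bar>\<psi> a\<bar> \<le> \<bar>\<phi> a\<bar>) \<Longrightarrow> P \<psi>"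
  shows "nu_kernel F K"
proof -
  have comb: "P (\<lambda>a. max (\<alpha> a + \<phi> a) (\<beta> a + \<psi> a))"
    if P: "P \<phi>" "P \<psi>" and "\<And>a. max (\<alpha> a) (\<beta> a) = 0" for \<alpha> \<beta> \<phi> \<psi>
  proof -
    have le0: "\<alpha> a \<le> 0" "\<beta> a \<le> 0" "\<alpha> a = 0 \<or> \<beta> a = 0" for a
      using that(3)[of a] by (auto simp: max_def split: if_splits)
    have abs: "P (\<lambda>a. \<bar>\<phi> a\<bar>)" if "P \<phi>" for \<phi> using mono[OF that] by simp
    have "P (\<lambda>a. \<bar>\<phi> a\<bar> + \<bar>\<psi> a\<bar>)" using add abs P by blast
    then show ?thesis
    proof (rule mono)
      fix a show "\<bar>max (\<alpha> a + \<phi> a) (\<beta> a + \<psi> a)\<bar> \<le> \<bar>\<bar>\<phi> a\<bar> + \<bar>\<psi> a\<bar>\<bar>"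
        using le0[of a] by (auto simp: max_def abs_if)
    qed
  qed
  have cls: "nu_class F \<theta> \<subseteq> K" if "P (\<lambda>a. val (\<theta> a))" for \<theta>
  proof
    fix c assume "c \<in> nu_class F \<theta>"
    then have "c \<in> rat_funs F" "(\<lambda>a. val (c a)) = (\<lambda>a. val (\<theta> a))" unfolding nu_class_val by auto
    then show "c \<in> K" using that assms(1) by simp
  qed
  have KP: "P (\<lambda>a. val (f a))" if "f \<in> K" for f using that assms(1) by blast
  show ?thesis unfolding nu_kernel_def
  proof (intro conjI ballI impI cls)
    show "K \<subseteq> rat_funs F" using assms(1) by blast
    have "(\<lambda>_. 1) \<in> K" using assms(1,2) const_in_rat_funs by simp
    then show "K \<noteq> {}" by blast
    fix f assume f: "f \<in> K"
    then show "P (\<lambda>a. val (f a))" by (rule KP)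
    show "P (\<lambda>a. val (star F (f a)))" using uminus[OF KP[OF f]] by (simp add: val_star)
    fix g assume g: "g \<in> K"
    show "P (\<lambda>a. val (f a * g a))" using add[OF KP[OF f] KP[OF g]] by (simp add: val_mult)
    fix \<alpha> \<beta> :: "('n \<Rightarrow> 'a) \<Rightarrow> 'a" assume "nu_eq_fun F (\<lambda>a. \<alpha> a + \<beta> a) (\<lambda>a. 1)"
    then have "max (val (\<alpha> a)) (val (\<beta> a)) = 0" for a
      unfolding nu_eq_fun_def nu_eq_val val_add by simp
    from comb[OF KP[OF f] KP[OF g] this] show "P (\<lambda>a. val (\<alpha> a * f a + \<beta> a * g a))"
      by (simp add: val_add val_mult)
  qed
qed

lemma nu_kernel_ideal: "nu_kernel F (ideal \<phi>)"
proof (rule nu_kernelI[where P = "\<lambda>\<psi>. \<exists>k::nat. \<forall>a. \<bar>\<psi> a\<bar> \<le> real k * \<bar>\<phi> a\<bar>", OF ideal_def])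
  show "\<exists>k::nat. \<forall>a. \<bar>\<psi> a + \<theta> a\<bar> \<le> real k * \<bar>\<phi> a\<bar>"
    if prems: "\<exists>k::nat. \<forall>a. \<bar>\<psi> a\<bar> \<le> real k * \<bar>\<phi> a\<bar>" "\<exists>k::nat. \<forall>a. \<bar>\<theta> a\<bar> \<le> real k * \<bar>\<phi> a\<bar>" for \<psi> \<theta>
  proof -
    obtain k where k: "\<forall>a. \<bar>\<psi> a\<bar> \<le> real k * \<bar>\<phi> a\<bar>" using prems(1) by blast
    obtain l where l: "\<forall>a. \<bar>\<theta> a\<bar> \<le> real l * \<bar>\<phi> a\<bar>" using prems(2) by blast
    have "\<bar>\<psi> a + \<theta> a\<bar> \<le> real (k + l) * \<bar>\<phi> a\<bar>" for a
      using k[rule_format, of a] l[rule_format, of a] abs_triangle_ineq[of "\<psi> a" "\<theta> a"] by (simp add: distrib_right)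
    then show ?thesis by blast
  qed
next
  show "\<exists>k::nat. \<forall>a. \<bar>\<theta> a\<bar> \<le> real k * \<bar>\<phi> a\<bar>"
    if "\<exists>k::nat. \<forall>a. \<bar>\<psi> a\<bar> \<le> real k * \<bar>\<phi> a\<bar>" "\<And>a. \<bar>\<theta> a\<bar> \<le> \<bar>\<psi> a\<bar>" for \<psi> \<theta>
    using that by (meson order_trans)
qed auto

lemma kernel_gen_eq:
  assumes "nu_kernel F K" "S \<subseteq> K" "\<And>L. nu_kernel F L \<Longrightarrow> S \<subseteq> L \<Longrightarrow> K \<subseteq> L"
  shows "kernel_gen F S = K"
  unfolding kernel_gen_def using assms by blast

lemma ideal_subset_kernel:
  assumes K: "nu_kernel F K" and f: "f \<in> K" "\<And>a. val (f a) = \<phi> a"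
  shows "ideal \<phi> \<subseteq> K"
proof
  fix g assume "g \<in> ideal \<phi>"
  then obtain k where k: "g \<in> rat_funs F" "\<And>a. \<bar>val (g a)\<bar> \<le> real k * \<bar>\<phi> a\<bar>"
    unfolding ideal_def by blast
  have fr: "f \<in> rat_funs F" using nu_kernel_rat[OF K] f by blast
  \<comment> \<open>Multiples start at 1, so that the base case is \<open>f\<close> itself; the
    bound with factor \<open>k\<close> is later weakened to \<open>Suc k\<close>.\<close>
  have "\<exists>u\<in>K. \<forall>a. val (u a) = real (Suc j) * \<phi> a" for j
  proof (induction j)
    case 0 then show ?case using f by auto
  next
    case (Suc j)
    then obtain u where u: "u \<in> K" "\<And>a. val (u a) = real (Suc j) * \<phi> a" by blast
    obtain v where v: "v \<in> rat_funs F" "\<And>a. val (v a) = val (f a) + val (u a)"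
      using rat_vals_add[OF rat_funs_val rat_funs_val, of f u] nu_kernel_rat[OF K] fr u
      unfolding rat_vals_iff by (metis subsetD)
    then have "v \<in> K" using nu_kernel_mult[OF K f(1) u(1)] by blast
    then show ?case using v u f by (auto simp: algebra_simps)
  qed
  then obtain u where u: "u \<in> K" "\<And>a. val (u a) = real (Suc k) * \<phi> a" by blast
  have "\<bar>val (g a)\<bar> \<le> \<bar>val (u a)\<bar>" for a
    using k(2)[of a] by (simp add: u abs_mult distrib_right)
  then show "g \<in> K" using nu_kernel_convex[OF K u(1) k(1)] by blast
qed

lemma kernel_gen_principal:
  assumes "f \<in> rat_funs F" shows "kernel_gen F {f} = ideal (\<lambda>a. val (f a))"
proof (rule kernel_gen_eq)
  have "f \<in> ideal (\<lambda>a. val (f a))" using assms by (intro idealI[of _ 1]) auto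
  then show "{f} \<subseteq> ideal (\<lambda>a. val (f a))" by blast
qed (auto simp: nu_kernel_ideal dest: ideal_subset_kernel)

section \<open>The kernel of the constants as the bounded functions\<close>

lemma val_unbounded:
  assumes "0 < val c" shows "\<exists>d. x \<le> val d"
proof -
  obtain k where "x \<le> real k * val c" using reals_Archimedean3[OF assms] by (meson less_imp_le)
  then show ?thesis using val_power by metis
qed

lemma nu_kernel_bounded:
  "nu_kernel F {f \<in> rat_funs F :: (('n::finite \<Rightarrow> 'a) \<Rightarrow> 'a) set. \<exists>N. \<forall>a. \<bar>val (f a)\<bar> \<le> N}"
proof (rule nu_kernelI[where P = "\<lambda>\<psi>. \<exists>N. \<forall>a. \<bar>\<psi> a\<bar> \<le> N", OF refl])
  show "\<exists>N. \<forall>a. \<bar>\<phi> a + \<psi> a\<bar> \<le> N" if "\<exists>N. \<forall>a. \<bar>\<phi> a\<bar> \<le> N" "\<exists>N. \<forall>a. \<bar>\<psi> a\<bar> \<le> N"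
    for \<phi> \<psi> :: "('n \<Rightarrow> 'a) \<Rightarrow> real"
    using that by (meson abs_triangle_ineq add_mono order_trans)
  show "\<exists>N. \<forall>a. \<bar>\<psi> a\<bar> \<le> N" if "\<exists>N. \<forall>a. \<bar>\<phi> a\<bar> \<le> N" "\<And>a. \<bar>\<psi> a\<bar> \<le> \<bar>\<phi> a\<bar>"
    for \<phi> \<psi> :: "('n \<Rightarrow> 'a) \<Rightarrow> real"
    using that by (meson order_trans)
qed auto

text \<open>If some value is positive, the values of constants exceed any real bound, so every
  bounded function lies below a constant and convexity applies. Otherwise all values are 0.\<close>

lemma const_kernel_eq:
  "const_kernel F = {f \<in> rat_funs F :: (('n::finite \<Rightarrow> 'a) \<Rightarrow> 'a) set. \<exists>N. \<forall>a. \<bar>val (f a)\<bar> \<le> N}"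
  (is "_ = ?B")
  unfolding const_kernel_def
proof (rule kernel_gen_eq)
  show "nu_kernel F ?B" by (rule nu_kernel_bounded)
  show "range (\<lambda>c a. c) \<subseteq> ?B"
    using const_in_rat_funs by auto
  fix L :: "(('n \<Rightarrow> 'a) \<Rightarrow> 'a) set" assume L: "nu_kernel F L" "range (\<lambda>c a. c) \<subseteq> L"
  show "?B \<subseteq> L"
  proof
    fix f assume "f \<in> ?B"
    then obtain N where f: "f \<in> rat_funs F" "\<And>a. \<bar>val (f a)\<bar> \<le> N" by blast
    have "\<exists>d. \<forall>a. \<bar>val (f a)\<bar> \<le> \<bar>val d\<bar>"
    proof (cases "\<exists>c. 0 < val c")
      case True
      then obtain d where "N \<le> val d" using val_unbounded by blast
      then show ?thesis using f(2) by (intro exI[of _ d]) (meson abs_ge_self order_trans)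
    next
      case False
      have "val x = 0" for x
        using False val_star[of x] by (metis linorder_neqE neg_0_less_iff_less)
      then show ?thesis by simp
    qed
    then obtain d where d: "\<And>a. \<bar>val (f a)\<bar> \<le> \<bar>val d\<bar>" by blast
    have "(\<lambda>_. d) \<in> L" using L(2) by blast
    from nu_kernel_convex[OF L(1) this f(1) d] show "f \<in> L" .
  qed
qed

lemma ideal_subset_const_kernel:
  assumes "\<phi> \<in> rat_vals"
  shows "ideal \<phi> \<subseteq> const_kernel F \<longleftrightarrow> (\<exists>N. \<forall>a. \<bar>\<phi> a\<bar> \<le> N)"
proof
  assume sub: "ideal \<phi> \<subseteq> const_kernel F"
  obtain f where f: "f \<in> rat_funs F" "\<phi> = (\<lambda>a. val (f a))" using assms unfolding rat_vals_iff by blast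
  then have "f \<in> ideal \<phi>" by (intro idealI[of _ 1]) auto
  then show "\<exists>N. \<forall>a. \<bar>\<phi> a\<bar> \<le> N" using sub f(2) unfolding const_kernel_eq by blast
next
  assume "\<exists>N. \<forall>a. \<bar>\<phi> a\<bar> \<le> N"
  then obtain N where N: "\<And>a. \<bar>\<phi> a\<bar> \<le> N" by blast
  have "\<bar>x\<bar> \<le> real k * N" if "\<bar>x\<bar> \<le> real k * \<bar>\<phi> a\<bar>" for x k a
    using that mult_left_mono[OF N[of a], of "real k"] by simp
  then show "ideal \<phi> \<subseteq> const_kernel F" unfolding const_kernel_eq ideal_def by blast
qed

lemma principal_kernels_const_eq:
  "principal_kernels_const F =
    {ideal \<phi> | \<phi> :: ('n::finite \<Rightarrow> 'a) \<Rightarrow> real. \<phi> \<in> rat_vals \<and> (\<exists>N. \<forall>a. \<bar>\<phi> a\<bar> \<le> N)}"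
proof -
  have "{kernel_gen F {f} | f :: ('n \<Rightarrow> 'a) \<Rightarrow> 'a. f \<in> rat_funs F} = (\<lambda>f. ideal (\<lambda>a. val (f a))) ` rat_funs F"
    using kernel_gen_principal by auto
  also have "\<dots> = ideal ` rat_vals" unfolding rat_vals_def by auto
  finally have eq: "{kernel_gen F {f} | f :: ('n \<Rightarrow> 'a) \<Rightarrow> 'a. f \<in> rat_funs F} = ideal ` rat_vals" .
  have "principal_kernels_const F =
      {ideal \<phi> | \<phi> :: ('n \<Rightarrow> 'a) \<Rightarrow> real. \<phi> \<in> rat_vals \<and> ideal \<phi> \<subseteq> const_kernel F}"
    unfolding principal_kernels_const_def eq by blast
  then show ?thesis by (simp add: ideal_subset_const_kernel cong: conj_cong)
qed

section \<open>Lattice operations on principal kernels\<close>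

lemma ideal_mono:
  assumes "\<And>a. \<bar>\<phi> a\<bar> \<le> real k * \<bar>\<psi> a\<bar>" shows "ideal \<phi> \<subseteq> ideal \<psi>"
proof
  fix g assume "g \<in> ideal \<phi>"
  then obtain l where l: "g \<in> rat_funs F" "\<And>a. \<bar>val (g a)\<bar> \<le> real l * \<bar>\<phi> a\<bar>"
    unfolding ideal_def by blast
  have "\<bar>val (g a)\<bar> \<le> real (l * k) * \<bar>\<psi> a\<bar>" for a
    using l(2)[of a] mult_left_mono[OF assms, of "real l" a] by (simp add: mult.assoc)
  then show "g \<in> ideal \<psi>" using idealI l(1) by blast
qed

lemma ideal_Int: "ideal \<phi> \<inter> ideal \<psi> = ideal (\<lambda>a. min \<bar>\<phi> a\<bar> \<bar>\<psi> a\<bar>)"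
proof
  show "ideal (\<lambda>a. min \<bar>\<phi> a\<bar> \<bar>\<psi> a\<bar>) \<subseteq> ideal \<phi> \<inter> ideal \<psi>"
    using ideal_mono[of "\<lambda>a. min \<bar>\<phi> a\<bar> \<bar>\<psi> a\<bar>" 1] by auto
  show "ideal \<phi> \<inter> ideal \<psi> \<subseteq> ideal (\<lambda>a. min \<bar>\<phi> a\<bar> \<bar>\<psi> a\<bar>)"
  proof
    fix g assume g: "g \<in> ideal \<phi> \<inter> ideal \<psi>"
    then obtain k l where kl: "\<And>a. \<bar>val (g a)\<bar> \<le> real k * \<bar>\<phi> a\<bar>" "\<And>a. \<bar>val (g a)\<bar> \<le> real l * \<bar>\<psi> a\<bar>"
      unfolding ideal_def by blast
    have "\<bar>val (g a)\<bar> \<le> real (k + l) * \<bar>min \<bar>\<phi> a\<bar> \<bar>\<psi> a\<bar>\<bar>" for a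
    proof (cases "\<bar>\<phi> a\<bar> \<le> \<bar>\<psi> a\<bar>")
      case True then show ?thesis using kl(1)[of a] by (simp add: distrib_right add_increasing2)
    next
      case False then show ?thesis using kl(2)[of a] by (simp add: distrib_right add_increasing)
    qed
    then show "g \<in> ideal (\<lambda>a. min \<bar>\<phi> a\<bar> \<bar>\<psi> a\<bar>)" using g idealI unfolding ideal_def by blast
  qed
qed

text \<open>The hard inclusion is Riesz decomposition: clamp a function below \<open>k (|\<phi>| + |\<psi>|)\<close> to the
  interval between \<open>- k |\<phi>|\<close> and \<open>k |\<phi>|\<close>.\<close>

lemma kernel_prod_ideal:
  assumes "\<phi> \<in> rat_vals"
  shows "kernel_prod F (ideal \<phi>) (ideal \<psi>) = ideal (\<lambda>a. \<bar>\<phi> a\<bar> + \<bar>\<psi> a\<bar>)" (is "?L = ?R")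
proof
  show "?L \<subseteq> ?R"
  proof
    fix c assume "c \<in> ?L"
    then obtain f g where fg: "f \<in> ideal \<phi>" "g \<in> ideal \<psi>" and c: "c \<in> rat_funs F"
      "\<And>a. val (c a) = val (f a) + val (g a)"
      unfolding kernel_prod_def nu_class_val val_mult by blast
    obtain k l where kl: "\<And>a. \<bar>val (f a)\<bar> \<le> real k * \<bar>\<phi> a\<bar>" "\<And>a. \<bar>val (g a)\<bar> \<le> real l * \<bar>\<psi> a\<bar>"
      using fg unfolding ideal_def by blast
    have "\<bar>val (c a)\<bar> \<le> real (k + l) * \<bar>\<bar>\<phi> a\<bar> + \<bar>\<psi> a\<bar>\<bar>" for a
    proof -
      have "\<bar>val (c a)\<bar> \<le> real k * \<bar>\<phi> a\<bar> + real l * \<bar>\<psi> a\<bar>"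
        using kl(1)[of a] kl(2)[of a] unfolding c(2) by (meson abs_triangle_ineq add_mono order_trans)
      also have "\<dots> \<le> real (k + l) * \<bar>\<phi> a\<bar> + real (k + l) * \<bar>\<psi> a\<bar>"
        by (intro add_mono mult_right_mono) auto
      finally show ?thesis by (simp add: distrib_left)
    qed
    then show "c \<in> ?R" by (intro idealI[OF c(1)])
  qed
  show "?R \<subseteq> ?L"
  proof
    fix c assume "c \<in> ?R"
    then obtain k where c: "c \<in> rat_funs F" and k: "\<And>a. \<bar>val (c a)\<bar> \<le> real k * (\<bar>\<phi> a\<bar> + \<bar>\<psi> a\<bar>)"
      unfolding ideal_def by auto
    define u where "u = (\<lambda>a. real k * \<bar>\<phi> a\<bar>)"
    have u: "u \<in> rat_vals" unfolding u_def using assms by (intro rat_vals_cmult rat_vals_abs)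
    obtain f where f: "f \<in> rat_funs F" "\<And>a. val (f a) = max (- u a) (min (val (c a)) (u a))"
      using rat_vals_max[OF rat_vals_uminus[OF u] rat_vals_min[OF rat_funs_val[OF c] u]]
      unfolding rat_vals_iff by metis
    obtain g where g: "g \<in> rat_funs F" "\<And>a. val (g a) = val (c a) - val (f a)"
      using rat_vals_diff[OF rat_funs_val[OF c] rat_funs_val[OF f(1)]] unfolding rat_vals_iff by metis
    have "0 \<le> u a" for a unfolding u_def by simp
    then have "\<bar>val (f a)\<bar> \<le> u a" for a unfolding f(2) by (auto simp: abs_le_iff min_def max_def)
    then have "f \<in> ideal \<phi>" unfolding u_def by (intro idealI[OF f(1)])
    moreover have "\<bar>val (g a)\<bar> \<le> real k * \<bar>\<psi> a\<bar>" for a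
      using k[of a] \<open>0 \<le> u a\<close> unfolding g(2) f(2) u_def by (auto simp: abs_if min_def max_def distrib_left split: if_splits)
    then have "g \<in> ideal \<psi>" by (intro idealI[OF g(1)])
    moreover have "c \<in> nu_class F (\<lambda>a. f a * g a)" using c g(2) unfolding nu_class_val by (simp add: val_mult)
    ultimately show "c \<in> ?L" unfolding kernel_prod_def by blast
  qed
qed

subsection \<open>Corner internal kernels\<close>

text \<open>At a ghost root that is no kernel root, the denominator is strictly below the numerator,
  so the sum equals \<open>h a\<close>. Uniqueness of the maximal monomial makes \<open>h a\<close>
  tangible, which contradicts disjointness from the ghosts.\<close>

lemma corner_internal_ideal:
  assumes S: "finite S" "S \<noteq> {}" and Q: "finite Q" "Q \<noteq> {}"
    and le: "\<And>a. poly_val Q a \<le> poly_val S a"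
    and uniq: "\<And>a m m'. poly_val Q a < poly_val S a \<Longrightarrow> m \<in> S \<Longrightarrow> m' \<in> S \<Longrightarrow>
      mono_val m a = poly_val S a \<Longrightarrow> mono_val m' a = poly_val S a \<Longrightarrow> m = m'"
  shows "ideal (\<lambda>a. poly_val S a - poly_val Q a) \<in> corner_internal_kernels F"
proof -
  obtain h where h: "h \<in> tangible_poly_funs F" "\<And>a. val (h a) = poly_val S a"
    and tan: "\<And>a m. range a \<subseteq> tangible F \<Longrightarrow> m \<in> S \<Longrightarrow>
      (\<And>m'. m' \<in> S \<Longrightarrow> m' \<noteq> m \<Longrightarrow> mono_val m' a < mono_val m a) \<Longrightarrow> h a \<in> tangible F"
    using tangible_realization[OF S] by metis
  obtain g where g: "g \<in> tangible_poly_funs F" "\<And>a. val (g a) = poly_val Q a"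
    using tangible_realization[OF Q] by metis
  have h': "h \<in> poly_funs" using h tangible_poly_funs_subset by blast
  have "a \<in> kernel_roots F (quot_fun F h g)" if a: "a \<in> ghost_roots F (\<lambda>a. g a + h a)" for a
  proof (rule ccontr)
    assume "a \<notin> kernel_roots F (quot_fun F h g)"
    then have lt: "poly_val Q a < poly_val S a"
      using le[of a] unfolding kernel_roots_def nu_eq_val by (simp add: val_quot_fun h g)
    then have "g a + h a = h a" using add_eq_left[of "g a" "h a"] by (simp add: add.commute h g)
    moreover obtain m where m: "m \<in> S" "mono_val m a = poly_val S a" using poly_val_attained[OF S] by metis
    have "h a \<in> tangible F"
    proof (rule tan[OF _ m(1)])
      show "range a \<subseteq> tangible F" using a unfolding ghost_roots_def by blast
      fix m' assume m': "m' \<in> S" "m' \<noteq> m"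
      then have "mono_val m' a \<noteq> poly_val S a" using uniq[OF lt] m by blast
      then show "mono_val m' a < mono_val m a" using poly_val_ge[OF S(1) m'(1), of a] m by simp
    qed
    ultimately show False using a tangible_ghost_disjoint unfolding ghost_roots_def by auto
  qed
  then have "corner_internal F (quot_fun F h g)" unfolding corner_internal_def using h' g(1) by blast
  moreover have rat: "quot_fun F h g \<in> rat_funs F" unfolding rat_funs_def using h' g(1) by blast
  moreover have "kernel_gen F {quot_fun F h g} = ideal (\<lambda>a. poly_val S a - poly_val Q a)"
    using kernel_gen_principal[OF rat] by (simp add: val_quot_fun h g)
  ultimately show ?thesis unfolding corner_internal_kernels_def by (metis (mono_tags, lifting) mem_Collect_eq)
qed

text \<open>Adding to the denominator the numerator lowered by \<open>val c\<close> truncates the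
  difference at \<open>val c\<close>. The denominator only grows, so uniqueness is still required
  only where \<open>Q\<close> lies strictly below \<open>S\<close>.\<close>

lemma truncated_corner_internal:
  assumes S: "finite S" "S \<noteq> {}" and Q: "finite Q" "Q \<noteq> {}" and c: "0 < val c"
    and le: "\<And>a. poly_val Q a \<le> poly_val S a"
    and uniq: "\<And>a m m'. poly_val Q a < poly_val S a \<Longrightarrow> m \<in> S \<Longrightarrow> m' \<in> S \<Longrightarrow>
      mono_val m a = poly_val S a \<Longrightarrow> mono_val m' a = poly_val S a \<Longrightarrow> m = m'"
  shows "ideal (\<lambda>a. min (poly_val S a - poly_val Q a) (val c)) \<in> corner_internal_kernels F"
    and "(\<lambda>a. min (poly_val S a - poly_val Q a) (val c)) \<in> rat_vals"
proof -
  define T where "T = poly_mult {(star F c, \<lambda>_. 0)} S"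
  have T: "finite T" "T \<noteq> {}" unfolding T_def using S by (simp_all add: poly_mult_finite poly_mult_nonempty)
  have Tv: "poly_val T a = poly_val S a - val c" for a
    unfolding T_def using S by (simp add: poly_val_mult mono_val_const val_star)
  have QT: "poly_val (Q \<union> T) a = max (poly_val Q a) (poly_val S a - val c)" for a
    using Q T by (simp add: poly_val_Un Tv)
  have eq: "(\<lambda>a. min (poly_val S a - poly_val Q a) (val c)) = (\<lambda>a. poly_val S a - poly_val (Q \<union> T) a)"
    unfolding QT by auto
  show "ideal (\<lambda>a. min (poly_val S a - poly_val Q a) (val c)) \<in> corner_internal_kernels F"
    unfolding eq
  proof (rule corner_internal_ideal[OF S])
    show "finite (Q \<union> T)" "Q \<union> T \<noteq> {}" using Q T by auto
    show "poly_val (Q \<union> T) a \<le> poly_val S a" for a using le[of a] c unfolding QT by simp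
  qed (use uniq QT in auto)
  show "(\<lambda>a. min (poly_val S a - poly_val Q a) (val c)) \<in> rat_vals"
    unfolding eq using S Q T by (intro rat_valsI) auto
qed

text \<open>The difference between the largest and the second largest of two, respectively three, affine
  functions. It vanishes exactly where the maximum is attained twice, and it is the difference of the
  polynomials \<open>\<Sum>i. p\<^sub>i\<^sup>2\<close> and \<open>\<Sum>i<j. p\<^sub>i p\<^sub>j\<close>, the first of which is locally a single monomial off
  that set.\<close>

definition gap2 where "gap2 p q a = \<bar>mono_val p a - mono_val q a\<bar>"

definition gap3 where "gap3 p q r a =
  2 * max (max (mono_val p a) (mono_val q a)) (mono_val r a) -
  max (max (mono_val p a + mono_val q a) (mono_val p a + mono_val r a)) (mono_val q a + mono_val r a)"

lemma gap2_nonneg: "0 \<le> gap2 p q a"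
  unfolding gap2_def by simp

lemma gap3_nonneg: "0 \<le> gap3 p q r a"
  unfolding gap3_def by (auto simp: max_def)

lemma gap2_corner_internal:
  assumes "0 < val c"
  shows "ideal (\<lambda>a. min (gap2 p q a) (val c)) \<in> corner_internal_kernels F"
    and "(\<lambda>a. min (gap2 p q a) (val c)) \<in> rat_vals"
proof -
  let ?S = "{mono_mult p p, mono_mult q q}" and ?Q = "{mono_mult p q}"
  have S: "poly_val ?S a = max (mono_val p a + mono_val p a) (mono_val q a + mono_val q a)" for a
    by (simp add: poly_val_insert mono_val_mult)
  have Q: "poly_val ?Q a = mono_val p a + mono_val q a" for a by (simp add: mono_val_mult)
  have gap: "gap2 p q a = poly_val ?S a - poly_val ?Q a" for a
    unfolding S Q gap2_def by auto
  have uniq: "m = m'" if "poly_val ?Q a < poly_val ?S a" "m \<in> ?S" "m' \<in> ?S"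
      "mono_val m a = poly_val ?S a" "mono_val m' a = poly_val ?S a" for a m m'
    using that unfolding S Q by (auto simp: mono_val_mult)
  have le: "poly_val ?Q a \<le> poly_val ?S a" for a using gap[of a] gap2_nonneg[of p q a] by simp
  show "ideal (\<lambda>a. min (gap2 p q a) (val c)) \<in> corner_internal_kernels F"
    "(\<lambda>a. min (gap2 p q a) (val c)) \<in> rat_vals"
    unfolding gap by (rule truncated_corner_internal[OF _ _ _ _ assms le uniq]; blast)+
qed

lemma gap3_corner_internal:
  assumes "0 < val c"
  shows "ideal (\<lambda>a. min (gap3 p q r a) (val c)) \<in> corner_internal_kernels F"
    and "(\<lambda>a. min (gap3 p q r a) (val c)) \<in> rat_vals"
proof -
  let ?S = "{mono_mult p p, mono_mult q q, mono_mult r r}"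
    and ?Q = "{mono_mult p q, mono_mult p r, mono_mult q r}"
  have S: "poly_val ?S a = max (mono_val p a + mono_val p a)
      (max (mono_val q a + mono_val q a) (mono_val r a + mono_val r a))" for a
    by (simp add: poly_val_insert mono_val_mult)
  have Q: "poly_val ?Q a = max (mono_val p a + mono_val q a)
      (max (mono_val p a + mono_val r a) (mono_val q a + mono_val r a))" for a
    by (simp add: poly_val_insert mono_val_mult)
  have gap: "gap3 p q r a = poly_val ?S a - poly_val ?Q a" for a
    unfolding S Q gap3_def by (auto simp: max_def)
  \<comment> \<open>If two different squares tie for the maximum, the corresponding mixed product
    has the same value, contrary to the strict inequality.\<close>
  have uniq: "m = m'" if "poly_val ?Q a < poly_val ?S a" "m \<in> ?S" "m' \<in> ?S"
      "mono_val m a = poly_val ?S a" "mono_val m' a = poly_val ?S a" for a m m'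
    using that unfolding S Q by (auto simp: mono_val_mult)
  have le: "poly_val ?Q a \<le> poly_val ?S a" for a using gap[of a] gap3_nonneg[of p q r a] by simp
  show "ideal (\<lambda>a. min (gap3 p q r a) (val c)) \<in> corner_internal_kernels F"
    "(\<lambda>a. min (gap3 p q r a) (val c)) \<in> rat_vals"
    unfolding gap by (rule truncated_corner_internal[OF _ _ _ _ assms le uniq]; blast)+
qed

section \<open>Sums and minima within a generated lattice\<close>

lemma lattice_gen_sum:
  assumes "finite R" and "ideal \<phi> \<in> lattice_gen F \<S>" "\<phi> \<in> rat_vals" "\<And>a. 0 \<le> \<phi> a"
    and "\<And>r. r \<in> R \<Longrightarrow> ideal (\<psi> r) \<in> lattice_gen F \<S>" "\<And>r. r \<in> R \<Longrightarrow> \<psi> r \<in> rat_vals"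
      "\<And>r a. r \<in> R \<Longrightarrow> 0 \<le> \<psi> r a"
  shows "ideal (\<lambda>a. \<phi> a + (\<Sum>r\<in>R. \<psi> r a)) \<in> lattice_gen F \<S>"
  using assms(1,5-7)
proof (induction R rule: finite_induct)
  \<comment> \<open>The separate summand \<open>\<phi>\<close> carries the base case: the trivial
    kernel is not assumed to lie in the generated lattice.\<close>
  case empty then show ?case using assms(2) by simp
next
  case (insert r R)
  have "ideal (\<lambda>a. \<phi> a + (\<Sum>r\<in>insert r R. \<psi> r a)) = ideal (\<lambda>a. \<bar>\<psi> r a\<bar> + \<bar>\<phi> a + (\<Sum>r\<in>R. \<psi> r a)\<bar>)"
    using insert assms(4) by (simp add: sum_nonneg ac_simps)
  also have "\<dots> = kernel_prod F (ideal (\<psi> r)) (ideal (\<lambda>a. \<phi> a + (\<Sum>r\<in>R. \<psi> r a)))"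
    using insert by (simp add: kernel_prod_ideal)
  also have "\<dots> \<in> lattice_gen F \<S>" using insert by (intro lattice_gen.prod) auto
  finally show ?case .
qed

lemma lattice_gen_Min:
  assumes "finite S" "S \<noteq> {}" and "\<And>s. s \<in> S \<Longrightarrow> ideal (w s) \<in> lattice_gen F \<S>" "\<And>s a. s \<in> S \<Longrightarrow> 0 \<le> w s a"
  shows "ideal (\<lambda>a. Min ((\<lambda>s. w s a) ` S)) \<in> lattice_gen F \<S>"
  using assms
proof (induction S rule: finite_ne_induct)
  case (singleton s) then show ?case by simp
next
  case (insert s S)
  have "0 \<le> Min ((\<lambda>s. w s a) ` S)" for a using insert by simp
  then have "ideal (\<lambda>a. Min ((\<lambda>s. w s a) ` insert s S)) =
      ideal (\<lambda>a. min \<bar>w s a\<bar> \<bar>Min ((\<lambda>s. w s a) ` S)\<bar>)"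
    using insert by simp
  also have "\<dots> = ideal (w s) \<inter> ideal (\<lambda>a. Min ((\<lambda>s. w s a) ` S))"
    by (rule ideal_Int[symmetric])
  also have "\<dots> \<in> lattice_gen F \<S>" using insert by (intro lattice_gen.inter) auto
  finally show ?case .
qed

text \<open>Truncation is subadditive on nonnegative numbers; this permits truncating each gap
  separately.\<close>

lemma min_add_sum_le:
  fixes x C :: real
  assumes "finite R" "0 \<le> x" "0 \<le> C" "\<And>r. r \<in> R \<Longrightarrow> 0 \<le> f r"
  shows "min (x + (\<Sum>r\<in>R. f r)) C \<le> min x C + (\<Sum>r\<in>R. min (f r) C)"
  using assms(1,4)
proof (induction R rule: finite_induct)
  case (insert r R)
  have "0 \<le> (\<Sum>r\<in>R. f r)" "0 \<le> f r" using insert by (auto intro: sum_nonneg)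
  moreover have "min (x + (\<Sum>r\<in>R. f r)) C \<le> min x C + (\<Sum>r\<in>R. min (f r) C)" using insert by simp
  moreover have "(\<Sum>r\<in>insert r R. f r) = f r + (\<Sum>r\<in>R. f r)"
    "(\<Sum>r\<in>insert r R. min (f r) C) = min (f r) C + (\<Sum>r\<in>R. min (f r) C)" using insert by auto
  ultimately show ?case using assms(2,3) by (simp add: min_def split: if_splits)
qed simp

text \<open>A pair \<open>(p, q) \<in> S\<close> stands for the polyhedron on which \<open>p = q\<close> is maximal in \<open>H \<union> G\<close>. The set \<open>R p q\<close>
  omits the monomials that equal \<open>p\<close> or \<open>q\<close> as functions, because their gap is not regular.\<close>

lemma ideal_decomposition:
  fixes H G :: "('a \<times> ('n::finite \<Rightarrow> nat)) set"
  assumes H: "finite H" "H \<noteq> {}" and G: "finite G" "G \<noteq> {}"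
    and \<phi>: "\<phi> = (\<lambda>a. poly_val H a - poly_val G a)" and N: "\<And>a. \<bar>\<phi> a\<bar> \<le> N" and C: "0 < C"
    and R: "\<And>p q. R p q = {r \<in> H \<union> G. mono_val r \<noteq> mono_val p \<and> mono_val r \<noteq> mono_val q}"
    and S: "finite S" "S \<noteq> {}"
    and pairs: "\<And>p q. (p, q) \<in> S \<Longrightarrow> p \<in> H \<and> (q \<in> G \<or> (\<exists>g\<in>G. mono_val g = mono_val p))"
    and cover: "\<And>a. \<exists>p q. (p, q) \<in> S \<and> gap2 p q a \<le> \<bar>\<phi> a\<bar> \<and>
      (\<forall>r\<in>H \<union> G. mono_val r a \<le> max (mono_val p a) (mono_val q a))"
  shows "ideal \<phi> = ideal (\<lambda>a. Min ((\<lambda>(p, q). min (gap2 p q a) C + (\<Sum>r\<in>R p q. min (gap3 p q r a) C)) ` S))"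
    (is "_ = ideal ?w")
proof
  let ?t = "\<lambda>a. \<lambda>(p, q). min (gap2 p q a) C + (\<Sum>r\<in>R p q. min (gap3 p q r a) C)"
  have finR: "finite (R p q)" for p q unfolding R using H G by simp
  have t_nonneg: "0 \<le> ?t a pq" for a pq
    using C by (auto simp: gap2_nonneg gap3_nonneg case_prod_unfold intro!: add_nonneg_nonneg sum_nonneg)
  have w_nonneg: "0 \<le> ?w a" for a using S t_nonneg[of a] by simp
  show "ideal ?w \<subseteq> ideal \<phi>"
  proof (rule ideal_mono)
    fix a
    obtain p q where pq: "(p, q) \<in> S" "gap2 p q a \<le> \<bar>\<phi> a\<bar>"
      "\<And>r. r \<in> H \<union> G \<Longrightarrow> mono_val r a \<le> max (mono_val p a) (mono_val q a)" using cover by blast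
    \<comment> \<open>Since \<open>r\<close> does not exceed the larger of \<open>p\<close> and
      \<open>q\<close> at \<open>a\<close>, its three-term gap is at most the distance of
      \<open>p\<close> and \<open>q\<close>.\<close>
    have "min (gap3 p q r a) C \<le> \<bar>\<phi> a\<bar>" if "r \<in> R p q" for r
    proof -
      have "mono_val r a \<le> max (mono_val p a) (mono_val q a)" using that pq(3) unfolding R by blast
      then have "gap3 p q r a \<le> gap2 p q a" unfolding gap3_def gap2_def by (auto simp: max_def abs_if)
      then show ?thesis using pq(2) by simp
    qed
    then have "(\<Sum>r\<in>R p q. min (gap3 p q r a) C) \<le> real (card (R p q)) * \<bar>\<phi> a\<bar>"
      by (rule sum_bounded_above)
    also have "\<dots> \<le> real (card (H \<union> G)) * \<bar>\<phi> a\<bar>"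
      using H G unfolding R by (intro mult_right_mono) (auto intro!: card_mono)
    finally have "?t a (p, q) \<le> real (Suc (card (H \<union> G))) * \<bar>\<phi> a\<bar>"
      using pq(2) by (simp add: distrib_right)
    moreover have "?w a \<le> ?t a (p, q)" using S pq(1) by (intro Min_le) auto
    ultimately show "\<bar>?w a\<bar> \<le> real (Suc (card (H \<union> G))) * \<bar>\<phi> a\<bar>" using w_nonneg[of a] by linarith
  qed
  \<comment> \<open>This is where boundedness enters: where the total gap exceeds \<open>C\<close>,
    a multiple of \<open>C\<close> dominates \<phi>.\<close>
  obtain k where k: "N \<le> real k * C" using reals_Archimedean3[OF C] by (meson less_imp_le)
  show "ideal \<phi> \<subseteq> ideal ?w"
  proof (rule ideal_mono)
    fix a
    have "?w a \<in> ?t a ` S" using S by (intro Min_in) auto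
    then obtain p q where pq: "(p, q) \<in> S" "?w a = ?t a (p, q)" by auto
    define D where "D = gap2 p q a + (\<Sum>r\<in>R p q. gap3 p q r a)"
    \<comment> \<open>If \<open>r\<close> is the largest of the three, its height above the smaller
      of \<open>p\<close> and \<open>q\<close> is \<open>gap2 + gap3\<close>; monomials outside
      \<open>R p q\<close> equal \<open>p\<close> or \<open>q\<close>.\<close>
    have le: "mono_val r a \<le> min (mono_val p a) (mono_val q a) + D" if r: "r \<in> H \<union> G" for r
    proof (cases "r \<in> R p q")
      case True
      then have "gap3 p q r a \<le> (\<Sum>r\<in>R p q. gap3 p q r a)"
        using finR by (intro member_le_sum gap3_nonneg)
      then show ?thesis unfolding D_def gap2_def gap3_def by (auto simp: max_def min_def abs_if split: if_splits)
    next
      case False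
      then have "mono_val r a = mono_val p a \<or> mono_val r a = mono_val q a" using r unfolding R by auto
      moreover have "0 \<le> (\<Sum>r\<in>R p q. gap3 p q r a)" by (intro sum_nonneg gap3_nonneg)
      ultimately show ?thesis unfolding D_def gap2_def by (auto simp: min_def abs_if)
    qed
    obtain h g where h: "h \<in> H" "mono_val h a = poly_val H a" and g: "g \<in> G" "mono_val g a = poly_val G a"
      using poly_val_attained[OF H] poly_val_attained[OF G] by metis
    \<comment> \<open>By \<open>pairs\<close>, one of \<open>p\<close>, \<open>q\<close> is bounded
      by each of the two maxima. Both maxima thus lie in an interval of length \<open>D\<close>
      starting at the smaller of \<open>p\<close> and \<open>q\<close>, and \<phi> is their
      difference.\<close>
    have "min (mono_val p a) (mono_val q a) \<le> poly_val H a"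
      using pairs[OF pq(1)] poly_val_ge[OF H(1), of p a] by auto
    moreover have "min (mono_val p a) (mono_val q a) \<le> poly_val G a"
      using pairs[OF pq(1)] poly_val_ge[OF G(1), of _ a] by (metis min.coboundedI1 min.coboundedI2)
    moreover have "poly_val H a \<le> min (mono_val p a) (mono_val q a) + D" using le[of h] h by simp
    moreover have "poly_val G a \<le> min (mono_val p a) (mono_val q a) + D" using le[of g] g by simp
    ultimately have D: "\<bar>\<phi> a\<bar> \<le> D" unfolding \<phi> by linarith
    then have D0: "0 \<le> D" by linarith
    have "\<bar>\<phi> a\<bar> \<le> real (Suc k) * min D C"
    proof (cases "D \<le> C")
      case True
      then show ?thesis using D D0 by (simp add: distrib_right add_increasing2)
    next
      case False
      then show ?thesis using N[of a] k C by (simp add: distrib_right)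
    qed
    also have "\<dots> \<le> real (Suc k) * ?t a (p, q)"
      unfolding D_def prod.case
      by (intro mult_left_mono min_add_sum_le finR gap2_nonneg gap3_nonneg less_imp_le[OF C]) simp
    finally show "\<bar>\<phi> a\<bar> \<le> real (Suc k) * \<bar>?w a\<bar>"
      using pq(2) w_nonneg[of a] by simp
  qed
qed

lemma decomposition_in_lattice:
  assumes c: "0 < val c" and S: "finite S" "S \<noteq> {}"
    and R: "\<And>p q. (p, q) \<in> S \<Longrightarrow> finite (R p q)"
    and 2: "\<And>p q. (p, q) \<in> S \<Longrightarrow> ideal (\<lambda>a. min (gap2 p q a) (val c)) \<in> \<S>"
    and 3: "\<And>p q r. (p, q) \<in> S \<Longrightarrow> r \<in> R p q \<Longrightarrow> ideal (\<lambda>a. min (gap3 p q r a) (val c)) \<in> \<S>"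
  shows "ideal (\<lambda>a. Min ((\<lambda>(p, q). min (gap2 p q a) (val c) +
    (\<Sum>r\<in>R p q. min (gap3 p q r a) (val c))) ` S)) \<in> lattice_gen F \<S>"
proof (rule lattice_gen_Min[OF S, of "\<lambda>s a. (\<lambda>(p, q). min (gap2 p q a) (val c) +
    (\<Sum>r\<in>R p q. min (gap3 p q r a) (val c))) s"])
  fix s assume s: "s \<in> S"
  obtain p q where pq: "s = (p, q)" by (cases s)
  show "ideal (\<lambda>a. (\<lambda>(p, q). min (gap2 p q a) (val c) +
    (\<Sum>r\<in>R p q. min (gap3 p q r a) (val c))) s) \<in> lattice_gen F \<S>"
    unfolding pq prod.case using s pq c
    by (intro lattice_gen_sum R lattice_gen.base 2 3)
       (auto simp: gap2_corner_internal gap3_corner_internal gap2_nonneg gap3_nonneg)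
  show "0 \<le> (\<lambda>(p, q). min (gap2 p q a) (val c) +
    (\<Sum>r\<in>R p q. min (gap3 p q r a) (val c))) s" for a
    unfolding pq prod.case using c by (auto intro!: add_nonneg_nonneg sum_nonneg simp: gap2_nonneg gap3_nonneg)
qed

subsection \<open>Regular kernels\<close>

text \<open>Reduces closure of a family of kernels to closure of a property of their generators
  under the two operations corresponding to product and intersection.\<close>

lemma lattice_gen_subset:
  fixes \<S> :: "(('n::finite \<Rightarrow> 'a) \<Rightarrow> 'a) set set"
  assumes "\<S> \<subseteq> {ideal \<phi> | \<phi>. \<phi> \<in> rat_vals \<and> P \<phi>}"
    and add: "\<And>\<phi> \<psi>. \<phi> \<in> rat_vals \<Longrightarrow> \<psi> \<in> rat_vals \<Longrightarrow> P \<phi> \<Longrightarrow> P \<psi> \<Longrightarrow> P (\<lambda>a. \<bar>\<phi> a\<bar> + \<bar>\<psi> a\<bar>)"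
    and min: "\<And>\<phi> \<psi>. \<phi> \<in> rat_vals \<Longrightarrow> \<psi> \<in> rat_vals \<Longrightarrow> P \<phi> \<Longrightarrow> P \<psi> \<Longrightarrow> P (\<lambda>a. min \<bar>\<phi> a\<bar> \<bar>\<psi> a\<bar>)"
  shows "lattice_gen F \<S> \<subseteq> {ideal \<phi> | \<phi>. \<phi> \<in> rat_vals \<and> P \<phi>}"
proof
  fix K assume "K \<in> lattice_gen F \<S>"
  then have "\<exists>\<phi>\<in>rat_vals. K = ideal \<phi> \<and> P \<phi>"
  proof induction
    case (base K) then show ?case using assms(1) by blast
  next
    case (prod K L)
    then obtain \<phi> \<psi> where *: "\<phi> \<in> rat_vals" "K = ideal \<phi>" "P \<phi>" "\<psi> \<in> rat_vals" "L = ideal \<psi>" "P \<psi>"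
      by blast
    then have "kernel_prod F K L = ideal (\<lambda>a. \<bar>\<phi> a\<bar> + \<bar>\<psi> a\<bar>)" by (simp add: kernel_prod_ideal)
    moreover have "(\<lambda>a. \<bar>\<phi> a\<bar> + \<bar>\<psi> a\<bar>) \<in> rat_vals" using * by (intro rat_vals_add rat_vals_abs)
    ultimately show ?case using add * by blast
  next
    case (inter K L)
    then obtain \<phi> \<psi> where *: "\<phi> \<in> rat_vals" "K = ideal \<phi>" "P \<phi>" "\<psi> \<in> rat_vals" "L = ideal \<psi>" "P \<psi>"
      by blast
    then have "K \<inter> L = ideal (\<lambda>a. min \<bar>\<phi> a\<bar> \<bar>\<psi> a\<bar>)" by (simp add: ideal_Int)
    moreover have "(\<lambda>a. min \<bar>\<phi> a\<bar> \<bar>\<psi> a\<bar>) \<in> rat_vals" using * by (intro rat_vals_min rat_vals_abs)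
    ultimately show ?case using min * by blast
  qed
  then show "K \<in> {ideal \<phi> | \<phi>. \<phi> \<in> rat_vals \<and> P \<phi>}" by blast
qed

text \<open>The zero set of \<phi> has empty interior.\<close>

definition reg :: "(('n::finite \<Rightarrow> 'a) \<Rightarrow> real) \<Rightarrow> bool" where
  "reg \<phi> \<longleftrightarrow> (\<forall>a U. \<phi> a = 0 \<longrightarrow> openin (point_topology F) U \<longrightarrow> a \<in> U \<longrightarrow> (\<exists>b\<in>U. \<phi> b \<noteq> 0))"

lemma regD: "reg \<phi> \<Longrightarrow> \<phi> a = 0 \<Longrightarrow> openin (point_topology F) U \<Longrightarrow> a \<in> U \<Longrightarrow> \<exists>b\<in>U. \<phi> b \<noteq> 0"
  unfolding reg_def by blast

lemma reg_mono: "reg \<psi> \<Longrightarrow> (\<And>a. \<phi> a = 0 \<Longrightarrow> \<psi> a = 0) \<Longrightarrow> reg \<phi>"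
  unfolding reg_def by metis

text \<open>Numerator and denominator agree exactly where the value of the quotient is 0, so
  regularity does not depend on the chosen fraction.\<close>

lemma regular_fun_iff:
  "f \<in> rat_funs F \<and> regular_fun F f \<longleftrightarrow> f \<in> rat_funs F \<and> reg (\<lambda>a. val (f a))"
proof -
  have "(\<forall>a\<in>kernel_roots F f. \<forall>U. openin (point_topology F) U \<and> a \<in> U \<longrightarrow> (\<exists>b\<in>U. \<not> nu_eq F (h b) (g b)))
      \<longleftrightarrow> reg (\<lambda>a. val (f a))" if "f = quot_fun F h g" for h g
    unfolding reg_def kernel_roots_def nu_eq_val that by (auto simp: val_quot_fun)
  then show ?thesis unfolding regular_fun_def rat_funs_def by (smt (verit) mem_Collect_eq)
qed

lemma regular_kernels_eq:
  "regular_kernels F = {ideal \<phi> | \<phi> :: ('n::finite \<Rightarrow> 'a) \<Rightarrow> real. \<phi> \<in> rat_vals \<and> reg \<phi>}"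
proof -
  have "regular_kernels F = {kernel_gen F {f} | f :: ('n \<Rightarrow> 'a) \<Rightarrow> 'a. f \<in> rat_funs F \<and> reg (\<lambda>a. val (f a))}"
    unfolding regular_kernels_def using regular_fun_iff by blast
  also have "\<dots> = {ideal (\<lambda>a. val (f a)) | f :: ('n \<Rightarrow> 'a) \<Rightarrow> 'a. f \<in> rat_funs F \<and> reg (\<lambda>a. val (f a))}"
    by (intro Collect_cong ex_cong1) (auto simp: kernel_gen_principal)
  also have "\<dots> = {ideal \<phi> | \<phi> :: ('n::finite \<Rightarrow> 'a) \<Rightarrow> real. \<phi> \<in> rat_vals \<and> reg \<phi>}"
    unfolding rat_vals_def by blast
  finally show ?thesis .
qed

lemma regular_principal_kernels_const_eq:
  "principal_kernels_const F \<inter> regular_kernels F =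
    {ideal \<phi> | \<phi> :: ('n::finite \<Rightarrow> 'a) \<Rightarrow> real. \<phi> \<in> rat_vals \<and> (\<exists>N. \<forall>a. \<bar>\<phi> a\<bar> \<le> N) \<and> reg \<phi>}"
proof (intro set_eqI iffI)
  fix K :: "(('n \<Rightarrow> 'a) \<Rightarrow> 'a) set"
  assume K: "K \<in> principal_kernels_const F \<inter> regular_kernels F"
  then obtain \<phi> where \<phi>: "\<phi> \<in> rat_vals" "reg \<phi>" "K = ideal \<phi>" unfolding regular_kernels_eq by blast
  moreover have "K \<subseteq> const_kernel F" using K unfolding principal_kernels_const_def by blast
  ultimately show "K \<in> {ideal \<phi> | \<phi>. \<phi> \<in> rat_vals \<and> (\<exists>N. \<forall>a. \<bar>\<phi> a\<bar> \<le> N) \<and> reg \<phi>}"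
    using ideal_subset_const_kernel by blast
qed (auto simp: principal_kernels_const_eq regular_kernels_eq)

section \<open>Open sets in terms of values\<close>

lemma topspace_nu_topology: "topspace (nu_topology F) = UNIV"
  unfolding nu_topology_def topology_generated_by_topspace by blast

lemma openin_nu_topology_ball:
  assumes "openin (nu_topology F) U" "x \<in> U"
  shows "\<exists>\<epsilon>>0. \<forall>y. \<bar>val y - val x\<bar> < \<epsilon> \<longrightarrow> y \<in> U"
proof -
  have "generate_topology_on
     ({UNIV} \<union> range (\<lambda>c. {b. nu_less F c b}) \<union> range (\<lambda>c. {b. nu_less F b c})) U"
    using assms(1) unfolding nu_topology_def by (simp add: openin_topology_generated_by_iff)
  then show ?thesis using assms(2)
  proof (induction arbitrary: x rule: generate_topology_on.induct)
    case (Int A B)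
    then obtain \<delta> \<epsilon> where "\<delta> > 0" "\<forall>y. \<bar>val y - val x\<bar> < \<delta> \<longrightarrow> y \<in> A"
      "\<epsilon> > 0" "\<forall>y. \<bar>val y - val x\<bar> < \<epsilon> \<longrightarrow> y \<in> B" by (metis IntD1 IntD2)
    then show ?case by (intro exI[of _ "min \<delta> \<epsilon>"]) auto
  next
    case (UN \<K>)
    then obtain A where "A \<in> \<K>" "x \<in> A" by blast
    then show ?case using UN.IH by (metis UnionI)
  next
    case (Basis A)
    then consider "A = UNIV" | c where "A = {b. nu_less F c b}" | c where "A = {b. nu_less F b c}" by blast
    then show ?case
    proof cases
      case 1 then show ?thesis by (auto intro: exI[of _ 1])
    next
      case 2
      then show ?thesis using Basis(2) unfolding nu_less_val by (intro exI[of _ "val x - val c"]) auto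
    next
      case 3
      then show ?thesis using Basis(2) unfolding nu_less_val by (intro exI[of _ "val c - val x"]) auto
    qed
  qed simp
qed

lemma val_trivial:
  assumes "\<nexists>c. 0 < val c" shows "val x = 0"
  using assms val_star[of x] by (metis linorder_neqE neg_0_less_iff_less)

text \<open>Rays are bounded by elements, so radii of neighbourhoods must be values. If no positive
  value lies below \<epsilon>, there is a least positive value, and it serves as radius.\<close>

lemma ex_small_or_minimal:
  assumes "0 < val c0" "0 < \<epsilon>"
  shows "\<exists>c. 0 < val c \<and> (\<forall>z. \<bar>val z\<bar> < val c \<longrightarrow> \<bar>val z\<bar> < \<epsilon>)"
proof (cases "\<exists>c. 0 < val c \<and> val c < \<epsilon>")
  case True then show ?thesis by (meson less_trans)
next
  case False
  then have large: "\<epsilon> \<le> val c" if "0 < val c" for c using that by force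
  define P where "P = val ` {c. 0 < val c}"
  have P: "P \<noteq> {}" "bdd_below P" unfolding P_def using assms by (auto intro: bdd_belowI less_imp_le)
  \<comment> \<open>Take \<open>c\<close> within \<epsilon> of the infimum. A smaller positive value
    would differ from \<open>val c\<close> by less than \<epsilon>, yet this difference is itself a
    positive value.\<close>
  have "Inf P < Inf P + \<epsilon>" using assms by simp
  then obtain x where x: "x \<in> P" "x < Inf P + \<epsilon>" using cInf_less_iff[OF P] by blast
  then obtain c where c: "0 < val c" "val c < Inf P + \<epsilon>" unfolding P_def by blast
  have zero: "val z = 0" if z: "\<bar>val z\<bar> < val c" for z
  proof (rule ccontr)
    assume "val z \<noteq> 0"
    then have "\<exists>w. 0 < val w \<and> val w = \<bar>val z\<bar>"
      by (cases "0 < val z") (auto intro: exI[of _ z] exI[of _ "star F z"] simp: val_star)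
    then obtain w where w: "0 < val w" "val w = \<bar>val z\<bar>" by blast
    then have "val w \<in> P" unfolding P_def by blast
    then have "Inf P \<le> val w" using P by (intro cInf_lower)
    moreover have "val (c * star F w) = val c - val w" by (simp add: val_mult val_star)
    then have "\<epsilon> \<le> val c - val w" using large[of "c * star F w"] z w by simp
    ultimately show False using c by simp
  qed
  have "\<bar>val z\<bar> < \<epsilon>" if "\<bar>val z\<bar> < val c" for z using zero[OF that] assms(2) by simp
  then show ?thesis using c(1) by blast
qed

lemma nu_topology_nbhd:
  assumes "0 < \<epsilon>"
  shows "\<exists>N. openin (nu_topology F) N \<and> x \<in> N \<and> (\<forall>y\<in>N. \<bar>val y - val x\<bar> < \<epsilon>)"
proof (cases "\<exists>c. 0 < val c")
  case False
  have "openin (nu_topology F) UNIV"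
    using openin_topspace[of "nu_topology F"] by (simp add: topspace_nu_topology)
  then show ?thesis using val_trivial[OF False] assms by (intro exI[of _ UNIV]) simp
next
  case True
  then obtain c where c: "0 < val c" "\<And>z. \<bar>val z\<bar> < val c \<Longrightarrow> \<bar>val z\<bar> < \<epsilon>"
    using ex_small_or_minimal assms by blast
  let ?N = "{b. nu_less F (x * star F c) b} \<inter> {b. nu_less F b (x * c)}"
  have "openin (nu_topology F) ?N"
    unfolding nu_topology_def by (intro openin_Int topology_generated_by_Basis; blast)
  moreover have "x \<in> ?N" unfolding nu_less_val using c by (simp add: val_mult val_star)
  moreover have "\<bar>val y - val x\<bar> < \<epsilon>" if "y \<in> ?N" for y
  proof -
    have "\<bar>val (y * star F x)\<bar> < val c" using that unfolding nu_less_val by (auto simp: val_mult val_star)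
    from c(2)[OF this] show ?thesis by (simp add: val_mult val_star)
  qed
  ultimately show ?thesis by blast
qed

lemma point_topology_nbhd:
  fixes a :: "'n::finite \<Rightarrow> 'a"
  assumes "0 < \<epsilon>"
  shows "\<exists>U. openin (point_topology F) U \<and> a \<in> U \<and> (\<forall>b\<in>U. \<forall>i. \<bar>val (b i) - val (a i)\<bar> < \<epsilon>)"
proof -
  have "\<forall>i. \<exists>N. openin (nu_topology F) N \<and> a i \<in> N \<and> (\<forall>y\<in>N. \<bar>val y - val (a i)\<bar> < \<epsilon>)"
    using nu_topology_nbhd[OF assms] by blast
  then obtain N where N: "\<And>i. openin (nu_topology F) (N i)" "\<And>i. a i \<in> N i"
      "\<And>i y. y \<in> N i \<Longrightarrow> \<bar>val y - val (a i)\<bar> < \<epsilon>"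
    by metis
  have "openin (point_topology F) (PiE UNIV N)"
    unfolding point_topology_def using N(1) by (subst openin_PiE) auto
  then show ?thesis using N by (intro exI[of _ "PiE UNIV N"]) (auto simp: PiE_iff)
qed

text \<open>Varying one coordinate is continuous, so openness is inherited by the slice through
  \<open>a\<close>; this produces the nearby points in \<open>reg_gap2\<close>.\<close>

lemma point_topology_slice:
  fixes a :: "'n::finite \<Rightarrow> 'a"
  assumes "openin (point_topology F) U" "a \<in> U"
  shows "\<exists>\<epsilon>>0. \<forall>y. \<bar>val y - val (a i)\<bar> < \<epsilon> \<longrightarrow> a(i := y) \<in> U"
proof -
  have "continuous_map (nu_topology F) (point_topology F) (\<lambda>y. a(i := y))"
    unfolding point_topology_def continuous_map_componentwise_UNIV
    by (auto simp: fun_upd_def topspace_nu_topology)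
  from openin_continuous_map_preimage[OF this assms(1)]
  have "openin (nu_topology F) {y. a(i := y) \<in> U}" by (simp add: topspace_nu_topology)
  then show ?thesis using openin_nu_topology_ball[of _ "a i"] assms(2) by fastforce
qed

lemma open_mono_val_less: "openin (point_topology F) {a :: 'n::finite \<Rightarrow> 'a. mono_val q a < mono_val p a}"
proof (subst openin_subopen, intro ballI)
  fix a :: "'n \<Rightarrow> 'a" assume "a \<in> {a. mono_val q a < mono_val p a}"
  then have \<delta>: "0 < mono_val p a - mono_val q a" by simp
  \<comment> \<open>\<open>E\<close> is a Lipschitz constant of \<open>p - q\<close> for the maximum
    norm. Dividing by \<open>1 + E\<close> handles \<open>E = 0\<close> and keeps the final estimate
    strict.\<close>
  define E where "E = (\<Sum>i\<in>UNIV. \<bar>real (snd p i) - real (snd q i)\<bar>)"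
  have E: "0 \<le> E" unfolding E_def by (intro sum_nonneg) auto
  define \<epsilon> where "\<epsilon> = (mono_val p a - mono_val q a) / (1 + E)"
  have \<epsilon>: "0 < \<epsilon>" unfolding \<epsilon>_def using \<delta> E by simp
  obtain U where U: "openin (point_topology F) U" "a \<in> U" "\<And>b i. b \<in> U \<Longrightarrow> \<bar>val (b i) - val (a i)\<bar> < \<epsilon>"
    using point_topology_nbhd[OF \<epsilon>] by metis
  have "mono_val q b < mono_val p b" if b: "b \<in> U" for b
  proof -
    have diff: "mono_val m a - mono_val m b = (\<Sum>i\<in>UNIV. real (snd m i) * (val (a i) - val (b i)))" for m
      unfolding mono_val_def by (simp add: right_diff_distrib sum_subtractf)
    have "(mono_val p a - mono_val q a) - (mono_val p b - mono_val q b) =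
        (mono_val p a - mono_val p b) - (mono_val q a - mono_val q b)" by simp
    also have "\<dots> = (\<Sum>i\<in>UNIV. (real (snd p i) - real (snd q i)) * (val (a i) - val (b i)))"
      unfolding diff by (simp add: left_diff_distrib sum_subtractf)
    also have "\<dots> \<le> (\<Sum>i\<in>UNIV. \<bar>real (snd p i) - real (snd q i)\<bar> * \<epsilon>)"
    proof (rule sum_mono)
      fix i
      have "\<bar>val (a i) - val (b i)\<bar> \<le> \<epsilon>" using U(3)[OF b, of i] by linarith
      then have "\<bar>real (snd p i) - real (snd q i)\<bar> * \<bar>val (a i) - val (b i)\<bar> \<le>
          \<bar>real (snd p i) - real (snd q i)\<bar> * \<epsilon>" by (intro mult_left_mono) auto
      then show "(real (snd p i) - real (snd q i)) * (val (a i) - val (b i)) \<le>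
          \<bar>real (snd p i) - real (snd q i)\<bar> * \<epsilon>"
        unfolding abs_mult[symmetric] by linarith
    qed
    also have "\<dots> = E * \<epsilon>" unfolding E_def by (simp add: sum_distrib_right)
    also have "\<dots> < (1 + E) * \<epsilon>" using \<epsilon> by simp
    also have "\<dots> = mono_val p a - mono_val q a" unfolding \<epsilon>_def using E by simp
    finally show ?thesis by simp
  qed
  then show "\<exists>T. openin (point_topology F) T \<and> a \<in> T \<and> T \<subseteq> {a. mono_val q a < mono_val p a}"
    using U by blast
qed

lemma topspace_point_topology: "topspace (point_topology F) = UNIV"
  unfolding point_topology_def by (simp add: topspace_nu_topology)

lemma open_all_mono_val_less:
  "finite T \<Longrightarrow> openin (point_topology F) {a :: 'n::finite \<Rightarrow> 'a. \<forall>t\<in>T. mono_val t a < mono_val s a}"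
proof (induction T rule: finite_induct)
  case empty then show ?case using openin_topspace[of "point_topology F"] by (simp add: topspace_point_topology)
next
  case (insert t T)
  have "{a. \<forall>t\<in>insert t T. mono_val t a < mono_val s a} =
      {a. mono_val t a < mono_val s a} \<inter> {a. \<forall>t\<in>T. mono_val t a < mono_val s a}" by auto
  then show ?case using openin_Int[OF open_mono_val_less insert.IH] by simp
qed

lemma open_rat_vals_pos:
  fixes \<phi> :: "('n::finite \<Rightarrow> 'a) \<Rightarrow> real"
  assumes "\<phi> \<in> rat_vals" shows "openin (point_topology F) {a. 0 < \<phi> a}"
proof -
  obtain S T where ST: "finite S" "S \<noteq> {}" "finite T" "T \<noteq> {}" "\<phi> = (\<lambda>a. poly_val S a - poly_val T a)"
    using rat_valsE[OF assms] .
  have "0 < \<phi> a \<longleftrightarrow> (\<exists>s\<in>S. \<forall>t\<in>T. mono_val t a < mono_val s a)" for a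
    unfolding ST(5) poly_val_def using ST by (auto simp: Max_gr_iff)
  then have "{a. 0 < \<phi> a} = (\<Union>s\<in>S. {a. \<forall>t\<in>T. mono_val t a < mono_val s a})" by auto
  then show ?thesis using open_all_mono_val_less[OF ST(3)] by auto
qed

lemma open_rat_vals_nonzero:
  fixes \<phi> :: "('n::finite \<Rightarrow> 'a) \<Rightarrow> real"
  assumes "\<phi> \<in> rat_vals" shows "openin (point_topology F) {a. \<phi> a \<noteq> 0}"
proof -
  have "{a. \<phi> a \<noteq> 0} = {a. 0 < \<phi> a} \<union> {a. 0 < - \<phi> a}" by auto
  then show ?thesis using open_rat_vals_pos[OF assms] open_rat_vals_pos[OF rat_vals_uminus[OF assms]] by auto
qed

text \<open>The zero set is the union of two zero sets with empty interior. Since the nonzero set of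
  one function is open, the neighbourhood can be shrunk to it before leaving the other zero
  set.\<close>

lemma reg_min:
  fixes \<phi> \<psi> :: "('n::finite \<Rightarrow> 'a) \<Rightarrow> real"
  assumes "\<phi> \<in> rat_vals" "\<psi> \<in> rat_vals" "reg \<phi>" "reg \<psi>"
  shows "reg (\<lambda>a. min \<bar>\<phi> a\<bar> \<bar>\<psi> a\<bar>)"
proof -
  have *: "\<exists>b\<in>U. \<phi> b \<noteq> 0 \<and> \<psi> b \<noteq> 0"
    if prems: "\<phi> \<in> rat_vals" "reg \<phi>" "reg \<psi>" "\<phi> a = 0" "openin (point_topology F) U" "a \<in> U"
    for \<phi> \<psi> :: "('n \<Rightarrow> 'a) \<Rightarrow> real" and a U
  proof -
    obtain b where b: "b \<in> U" "\<phi> b \<noteq> 0" using regD[OF prems(2,4-6)] by blast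
    show ?thesis
    proof (cases "\<psi> b = 0")
      case True
      have "openin (point_topology F) (U \<inter> {a. \<phi> a \<noteq> 0})"
        using prems(5) open_rat_vals_nonzero[OF prems(1)] by blast
      from regD[OF prems(3) True this] b prems(6) show ?thesis by blast
    qed (use b in blast)
  qed
  show ?thesis unfolding reg_def
  proof (intro allI impI)
    fix a U assume a: "min \<bar>\<phi> a\<bar> \<bar>\<psi> a\<bar> = 0" and U: "openin (point_topology F) U" "a \<in> U"
    then consider "\<phi> a = 0" | "\<psi> a = 0" by (auto simp: min_def split: if_splits)
    then have "\<exists>b\<in>U. \<phi> b \<noteq> 0 \<and> \<psi> b \<noteq> 0"
      using *[OF assms(1,3,4) _ U] *[OF assms(2,4,3) _ U] by cases blast+
    then show "\<exists>b\<in>U. min \<bar>\<phi> b\<bar> \<bar>\<psi> b\<bar> \<noteq> 0" by (auto simp: min_def)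
  qed
qed

section \<open>Regularity of the gaps\<close>

lemma mono_val_upd: "mono_val p (a(i := y)) = mono_val p a + real (snd p i) * (val y - val (a i))"
proof -
  have "(\<Sum>j\<in>UNIV. real (snd p j) * val ((a(i := y)) j)) =
      (\<Sum>j\<in>UNIV. real (snd p j) * val (a j) + (if j = i then real (snd p i) * (val y - val (a i)) else 0))"
    by (intro sum.cong) (auto simp: algebra_simps)
  then show ?thesis unfolding mono_val_def by (simp add: sum.distrib)
qed

text \<open>Different affine functions that agree at a point have different slopes in some
  coordinate, and density allows an arbitrarily small move in that coordinate.\<close>

lemma reg_gap2:
  fixes p q :: "'a \<times> ('n::finite \<Rightarrow> nat)"
  assumes dense: "\<And>\<epsilon>. 0 < \<epsilon> \<Longrightarrow> \<exists>c. 0 < val c \<and> val c < \<epsilon>" and "mono_val p \<noteq> mono_val q"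
  shows "reg (gap2 p q)"
  unfolding reg_def
proof (intro allI impI)
  fix a U assume a: "gap2 p q a = 0" and U: "openin (point_topology F) U" "a \<in> U"
  then have eq: "mono_val p a = mono_val q a" unfolding gap2_def by simp
  have "\<exists>i. snd p i \<noteq> snd q i"
  proof (rule ccontr)
    assume "\<nexists>i. snd p i \<noteq> snd q i"
    then have "mono_val p b - mono_val q b = val (fst p) - val (fst q)" for b unfolding mono_val_def by simp
    then have "mono_val p b = mono_val q b" for b using eq by (metis eq_iff_diff_eq_0)
    then show False using assms(2) by blast
  qed
  then obtain i where i: "snd p i \<noteq> snd q i" by blast
  obtain \<epsilon> where \<epsilon>: "\<epsilon> > 0" "\<And>y. \<bar>val y - val (a i)\<bar> < \<epsilon> \<Longrightarrow> a(i := y) \<in> U"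
    using point_topology_slice[OF U] by metis
  obtain c where c: "0 < val c" "val c < \<epsilon>" using dense[OF \<epsilon>(1)] by blast
  have "a(i := a i * c) \<in> U" using c by (intro \<epsilon>(2)) (simp add: val_mult)
  moreover have "gap2 p q (a(i := a i * c)) \<noteq> 0"
    using i c eq unfolding gap2_def mono_val_upd by (simp add: val_mult)
  ultimately show "\<exists>b\<in>U. gap2 p q b \<noteq> 0" by blast
qed

lemma gap2_rat_vals: "gap2 p q \<in> rat_vals"
proof -
  have "(\<lambda>a. \<bar>mono_val p a - mono_val q a\<bar>) \<in> rat_vals"
    by (intro rat_vals_abs rat_vals_diff mono_val_in_rat_vals)
  then show ?thesis unfolding gap2_def[abs_def] .
qed

text \<open>Where \<open>gap3\<close> vanishes, two of the three monomials tie, so the zero set lies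
  in the union of three pairwise zero sets.\<close>

lemma reg_gap3:
  assumes dense: "\<And>\<epsilon>. 0 < \<epsilon> \<Longrightarrow> \<exists>c. 0 < val c \<and> val c < \<epsilon>"
    and "mono_val p \<noteq> mono_val q" "mono_val p \<noteq> mono_val r" "mono_val q \<noteq> mono_val r"
  shows "reg (gap3 p q r)"
proof -
  have "reg (\<lambda>a. min \<bar>gap2 p q a\<bar> \<bar>min \<bar>gap2 p r a\<bar> \<bar>gap2 q r a\<bar>\<bar>)"
    using assms by (intro reg_min reg_gap2 gap2_rat_vals rat_vals_min rat_vals_abs) auto
  then show ?thesis
    by (rule reg_mono) (auto simp: gap3_def gap2_def max_def min_def split: if_splits)
qed

subsection \<open>Generation by corner internal kernels\<close>

lemma truncation_bounded: "0 < val c \<Longrightarrow> 0 \<le> x \<Longrightarrow> \<bar>min x (val c)\<bar> \<le> val c"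
  by simp

text \<open>All pairs in \<open>H \<times> G\<close> are used: at each point a maximal monomial of
  \<open>H\<close> and one of \<open>G\<close> have distance exactly
  \<open>\<bar>\<phi>\<bar>\<close>, which gives the covering condition.\<close>

lemma principal_in_lattice_gen:
  fixes \<phi> :: "('n::finite \<Rightarrow> 'a) \<Rightarrow> real"
  assumes \<phi>: "\<phi> \<in> rat_vals" and bounded: "\<And>a. \<bar>\<phi> a\<bar> \<le> N" and c: "0 < val c"
  shows "ideal \<phi> \<in> lattice_gen F (principal_kernels_const F \<inter> corner_internal_kernels F)"
proof -
  obtain H G where HG: "finite H" "H \<noteq> {}" "finite G" "G \<noteq> {}" "\<phi> = (\<lambda>a. poly_val H a - poly_val G a)"
    using rat_valsE[OF \<phi>] .
  define R where "R = (\<lambda>p q. {r \<in> H \<union> G. mono_val r \<noteq> mono_val p \<and> mono_val r \<noteq> mono_val q})"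
  have "ideal \<phi> = ideal (\<lambda>a. Min ((\<lambda>(p, q). min (gap2 p q a) (val c) +
    (\<Sum>r\<in>R p q. min (gap3 p q r a) (val c))) ` (H \<times> G)))"
  proof (rule ideal_decomposition[OF HG bounded c])
    show "\<exists>p q. (p, q) \<in> H \<times> G \<and> gap2 p q a \<le> \<bar>\<phi> a\<bar> \<and>
      (\<forall>r\<in>H \<union> G. mono_val r a \<le> max (mono_val p a) (mono_val q a))" for a
    proof -
      obtain h where h: "h \<in> H" "mono_val h a = poly_val H a" using poly_val_attained[OF HG(1,2)] by metis
      obtain g where g: "g \<in> G" "mono_val g a = poly_val G a" using poly_val_attained[OF HG(3,4)] by metis
      have "mono_val r a \<le> max (mono_val h a) (mono_val g a)" if "r \<in> H \<union> G" for r
        using that poly_val_ge[OF HG(1), of r a] poly_val_ge[OF HG(3), of r a] h g by auto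
      moreover have "gap2 h g a \<le> \<bar>\<phi> a\<bar>" unfolding gap2_def HG(5) h g by simp
      ultimately show ?thesis using h g by blast
    qed
  qed (use HG R_def in auto)
  also have "\<dots> \<in> lattice_gen F (principal_kernels_const F \<inter> corner_internal_kernels F)"
  proof (rule decomposition_in_lattice[OF c])
    show "finite (R p q)" for p q unfolding R_def using HG by simp
    show "ideal (\<lambda>a. min (gap2 p q a) (val c)) \<in> principal_kernels_const F \<inter> corner_internal_kernels F" for p q
      using gap2_corner_internal[OF c, of p q] truncation_bounded[OF c gap2_nonneg[of p q]]
      unfolding principal_kernels_const_eq by blast
    show "ideal (\<lambda>a. min (gap3 p q r a) (val c)) \<in> principal_kernels_const F \<inter> corner_internal_kernels F" for p q r
      using gap3_corner_internal[OF c, of p q r] truncation_bounded[OF c gap3_nonneg[of p q r]]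
      unfolding principal_kernels_const_eq by blast
  qed (use HG in auto)
  finally show ?thesis .
qed

lemma const_corner_internal:
  assumes "0 \<le> val c"
  shows "ideal (\<lambda>_ :: 'n::finite \<Rightarrow> 'a. val c) \<in> corner_internal_kernels F"
proof -
  have "ideal (\<lambda>a :: 'n \<Rightarrow> 'a. poly_val {(c, \<lambda>_. 0)} a - poly_val {(1, \<lambda>_. 0)} a) \<in> corner_internal_kernels F"
    by (rule corner_internal_ideal) (use assms in \<open>auto simp: mono_val_const\<close>)
  then show ?thesis by (simp add: mono_val_const)
qed

lemma rat_vals_trivial:
  assumes "\<phi> \<in> rat_vals" "\<nexists>c. 0 < val c" shows "\<phi> = (\<lambda>_. 0)"
proof -
  obtain f where "\<phi> = (\<lambda>a. val (f a))" using assms(1) unfolding rat_vals_iff by blast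
  then show ?thesis by (simp add: val_trivial[OF assms(2)])
qed

theorem principal_kernels_const_generated:
  "principal_kernels_const F =
    (lattice_gen F (principal_kernels_const F \<inter> corner_internal_kernels F) :: (('n::finite \<Rightarrow> 'a) \<Rightarrow> 'a) set set)"
proof
  show "lattice_gen F (principal_kernels_const F \<inter> corner_internal_kernels F) \<subseteq>
    (principal_kernels_const F :: (('n \<Rightarrow> 'a) \<Rightarrow> 'a) set set)"
    unfolding principal_kernels_const_eq
  proof (rule lattice_gen_subset)
    fix \<phi> \<psi> :: "('n \<Rightarrow> 'a) \<Rightarrow> real"
    assume "\<exists>N. \<forall>a. \<bar>\<phi> a\<bar> \<le> N" "\<exists>N. \<forall>a. \<bar>\<psi> a\<bar> \<le> N"
    then obtain M N where MN: "\<And>a. \<bar>\<phi> a\<bar> \<le> M" "\<And>a. \<bar>\<psi> a\<bar> \<le> N" by blast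
    show "\<exists>N. \<forall>a. \<bar>\<bar>\<phi> a\<bar> + \<bar>\<psi> a\<bar>\<bar> \<le> N"
      using add_mono[OF MN] by (intro exI[of _ "M + N"]) simp
    show "\<exists>N. \<forall>a. \<bar>min \<bar>\<phi> a\<bar> \<bar>\<psi> a\<bar>\<bar> \<le> N"
      using MN(1) by (intro exI[of _ M]) (simp add: min.coboundedI1)
  qed blast
  show "(principal_kernels_const F :: (('n \<Rightarrow> 'a) \<Rightarrow> 'a) set set) \<subseteq>
    lattice_gen F (principal_kernels_const F \<inter> corner_internal_kernels F)"
  proof
    fix K :: "(('n \<Rightarrow> 'a) \<Rightarrow> 'a) set" assume K: "K \<in> principal_kernels_const F"
    then obtain \<phi> N where \<phi>: "K = ideal \<phi>" "\<phi> \<in> rat_vals" "\<And>a. \<bar>\<phi> a\<bar> \<le> N"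
      unfolding principal_kernels_const_eq by blast
    show "K \<in> lattice_gen F (principal_kernels_const F \<inter> corner_internal_kernels F)"
    proof (cases "\<exists>c. 0 < val c")
      case True
      then show ?thesis using principal_in_lattice_gen \<phi> by blast
    next
      case False
      \<comment> \<open>Over the trivial value group every function has value 0, so \<open>K\<close>
        is the kernel of the constant 1.\<close>
      then have "K \<in> corner_internal_kernels F"
        using rat_vals_trivial[OF \<phi>(2)] const_corner_internal[of 1] \<phi>(1) by simp
      then show ?thesis using K by (intro lattice_gen.base) blast
    qed
  qed
qed

section \<open>The sublattice of regular kernels\<close>

lemma reg_discrete_nonzero:
  assumes "\<phi> \<in> rat_vals" "reg \<phi>" and c: "0 < val c" "\<And>z. 0 < val z \<Longrightarrow> val c \<le> val z"
  shows "val c \<le> \<bar>\<phi> a\<bar>"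
proof -
  have zero: "val z = 0" if "\<bar>val z\<bar> < val c" for z
    using that c(2)[of z] c(2)[of "star F z"]
    by (cases "val z" "0 :: real" rule: linorder_cases) (auto simp: val_star)
  obtain f where f: "f \<in> rat_funs F" "\<phi> = (\<lambda>a. val (f a))" using assms(1) unfolding rat_vals_iff by blast
  obtain S T where ST: "\<phi> = (\<lambda>a. poly_val S a - poly_val T a)" using rat_valsE[OF assms(1)] .
  obtain U where U: "openin (point_topology F) U" "a \<in> U" "\<And>b i. b \<in> U \<Longrightarrow> \<bar>val (b i) - val (a i)\<bar> < val c"
    using point_topology_nbhd[OF c(1)] by metis
  \<comment> \<open>With radius the least positive value, all points of \<open>U\<close> have the
    same coordinate values as \<open>a\<close>, so a zero at \<open>a\<close> would be a zero on all
    of \<open>U\<close>.\<close>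
  have "\<phi> b = \<phi> a" if "b \<in> U" for b
  proof -
    have "val (b i) = val (a i)" for i
      using zero[of "b i * star F (a i)"] U(3)[OF that, of i] by (simp add: val_mult val_star)
    then have "mono_val m b = mono_val m a" for m unfolding mono_val_def by simp
    then show ?thesis unfolding ST poly_val_def by simp
  qed
  then have "\<phi> a \<noteq> 0" using regD[OF assms(2) _ U(1,2)] by metis
  then show ?thesis using zero[of "f a"] unfolding f(2) by force
qed

lemma regular_discrete:
  assumes \<phi>: "\<phi> \<in> rat_vals" "reg \<phi>" and bounded: "\<And>a. \<bar>\<phi> a\<bar> \<le> N"
    and c: "0 < val c" "\<And>z. 0 < val z \<Longrightarrow> val c \<le> val z"
  shows "ideal \<phi> = ideal (\<lambda>_. val c)"
proof
  obtain k where k: "N \<le> real k * val c" using reals_Archimedean3[OF c(1)] by (meson less_imp_le)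
  show "ideal \<phi> \<subseteq> ideal (\<lambda>_. val c)"
    by (rule ideal_mono[of _ k]) (use k bounded c(1) in \<open>auto intro: order_trans\<close>)
  show "ideal (\<lambda>_. val c) \<subseteq> ideal \<phi>"
    by (rule ideal_mono[of _ 1]) (use reg_discrete_nonzero[OF \<phi> c] c(1) in auto)
qed

lemma regular_in_lattice_gen:
  fixes \<phi> :: "('n::finite \<Rightarrow> 'a) \<Rightarrow> real"
  assumes \<phi>: "\<phi> \<in> rat_vals" and reg: "reg \<phi>" and bounded: "\<And>a. \<bar>\<phi> a\<bar> \<le> N" and c: "0 < val c"
    and dense: "\<And>\<epsilon>. 0 < \<epsilon> \<Longrightarrow> \<exists>c. 0 < val c \<and> val c < \<epsilon>"
  shows "ideal \<phi> \<in> lattice_gen F (principal_kernels_const F \<inter> regular_kernels F \<inter> corner_internal_kernels F)"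
proof -
  obtain H G where HG: "finite H" "H \<noteq> {}" "finite G" "G \<noteq> {}" "\<phi> = (\<lambda>a. poly_val H a - poly_val G a)"
    using rat_valsE[OF \<phi>] .
  define R where "R = (\<lambda>p q. {r \<in> H \<union> G. mono_val r \<noteq> mono_val p \<and> mono_val r \<noteq> mono_val q})"
  define S where "S = {(p, q). p \<in> H \<and> q \<in> H \<union> G \<and> mono_val p \<noteq> mono_val q \<and>
    (q \<in> G \<or> (\<exists>g\<in>G. mono_val g = mono_val p))}"
  have cover: "\<exists>p q. (p, q) \<in> S \<and> gap2 p q a \<le> \<bar>\<phi> a\<bar> \<and>
      (\<forall>r\<in>H \<union> G. mono_val r a \<le> max (mono_val p a) (mono_val q a))" for a
  proof -
    obtain h where h: "h \<in> H" "mono_val h a = poly_val H a" using poly_val_attained[OF HG(1,2)] by metis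
    obtain g where g: "g \<in> G" "mono_val g a = poly_val G a" using poly_val_attained[OF HG(3,4)] by metis
    have le: "mono_val r a \<le> max (mono_val h a) (mono_val g a)" if "r \<in> H \<union> G" for r
      using that poly_val_ge[OF HG(1), of r a] poly_val_ge[OF HG(3), of r a] h g by auto
    show ?thesis
    proof (cases "mono_val h = mono_val g")
      case False
      then have "(h, g) \<in> S" unfolding S_def using h g by blast
      moreover have "gap2 h g a \<le> \<bar>\<phi> a\<bar>" unfolding gap2_def HG(5) h g by simp
      ultimately show ?thesis using le by blast
    next
      case True
      then have zero: "\<phi> a = 0" unfolding HG(5) using h(2) g(2) by simp
      \<comment> \<open>On this open set \<open>h\<close> and its copies strictly dominate. As
        \<open>h\<close> occurs in both polynomials, \<phi> vanishes on the set, so regularity keeps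
        \<open>a\<close> out of it and a different function \<open>r\<close> ties with
        \<open>h\<close> at \<open>a\<close>.\<close>
      let ?V = "{b. \<forall>r\<in>{r \<in> H \<union> G. mono_val r \<noteq> mono_val h}. mono_val r b < mono_val h b}"
      have "openin (point_topology F) ?V" using HG by (intro open_all_mono_val_less) simp
      moreover have "\<phi> b = 0" if "b \<in> ?V" for b
      proof -
        have "mono_val r b < mono_val h b" if "r \<in> H \<union> G" "mono_val r \<noteq> mono_val h" for r
          using that \<open>b \<in> ?V\<close> by blast
        then have below: "mono_val r b \<le> mono_val h b" if "r \<in> H \<union> G" for r
          using that by (cases "mono_val r = mono_val h") (simp_all add: less_imp_le)
        have "poly_val H b = mono_val h b" using below h(1) HG by (intro poly_val_eqI) auto
        moreover have "poly_val G b = mono_val g b" using below g(1) HG True by (intro poly_val_eqI) auto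
        ultimately show ?thesis unfolding HG(5) True by simp
      qed
      ultimately have "a \<notin> ?V" using regD[OF reg zero] by blast
      then have "\<exists>r\<in>H \<union> G. mono_val r \<noteq> mono_val h \<and> \<not> mono_val r a < mono_val h a" by blast
      then obtain r where r: "r \<in> H \<union> G" "mono_val h \<noteq> mono_val r" "mono_val h a \<le> mono_val r a"
        unfolding not_less by metis
      then have eq: "mono_val r a = mono_val h a" using le[of r] True by simp
      have "\<exists>g\<in>G. mono_val g = mono_val h" using g(1) True by metis
      then have "(h, r) \<in> S" unfolding S_def using h(1) r(1,2) by blast
      moreover have "gap2 h r a \<le> \<bar>\<phi> a\<bar>" unfolding gap2_def eq by simp
      moreover have "mono_val r' a \<le> max (mono_val h a) (mono_val r a)" if "r' \<in> H \<union> G" for r'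
        using le[OF that] True eq by simp
      ultimately show ?thesis by blast
    qed
  qed
  have S: "finite S" "S \<noteq> {}"
  proof -
    have "S \<subseteq> H \<times> (H \<union> G)" unfolding S_def by auto
    then show "finite S" using HG(1,3) by (meson finite_SigmaI finite_UnI finite_subset)
    show "S \<noteq> {}" using cover by blast
  qed
  have "ideal \<phi> = ideal (\<lambda>a. Min ((\<lambda>(p, q). min (gap2 p q a) (val c) +
    (\<Sum>r\<in>R p q. min (gap3 p q r a) (val c))) ` S))"
    by (rule ideal_decomposition[OF HG bounded c _ S _ cover]) (auto simp: R_def S_def)
  also have "\<dots> \<in> lattice_gen F (principal_kernels_const F \<inter> regular_kernels F \<inter> corner_internal_kernels F)"
  proof (rule decomposition_in_lattice[OF c S])
    fix p q assume pq: "(p, q) \<in> S"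
    then have neq: "mono_val p \<noteq> mono_val q" unfolding S_def by blast
    show "finite (R p q)" unfolding R_def using HG by simp
    have "reg (\<lambda>a. min (gap2 p q a) (val c))"
      using c by (intro reg_mono[OF reg_gap2[OF dense neq]]) (auto simp: min_def split: if_splits)
    then show "ideal (\<lambda>a. min (gap2 p q a) (val c)) \<in>
        principal_kernels_const F \<inter> regular_kernels F \<inter> corner_internal_kernels F"
      using gap2_corner_internal[OF c, of p q] truncation_bounded[OF c gap2_nonneg[of p q]]
      unfolding principal_kernels_const_eq regular_kernels_eq by blast
    fix r assume "r \<in> R p q"
    then have "mono_val p \<noteq> mono_val r" "mono_val q \<noteq> mono_val r" unfolding R_def by auto
    then have "reg (\<lambda>a. min (gap3 p q r a) (val c))"
      using c by (intro reg_mono[OF reg_gap3[OF dense neq]]) (auto simp: min_def split: if_splits)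
    then show "ideal (\<lambda>a. min (gap3 p q r a) (val c)) \<in>
        principal_kernels_const F \<inter> regular_kernels F \<inter> corner_internal_kernels F"
      using gap3_corner_internal[OF c, of p q r] truncation_bounded[OF c gap3_nonneg[of p q r]]
      unfolding principal_kernels_const_eq regular_kernels_eq by blast
  qed
  finally show ?thesis .
qed

text \<open>If positive values stay above \<epsilon>, then \<open>ex_small_or_minimal\<close> yields
  a \<open>c\<close> below which every value is smaller than \<epsilon>, hence no positive
  one.\<close>

lemma dense_or_discrete:
  assumes "0 < val c0"
  obtains "\<And>\<epsilon>. 0 < \<epsilon> \<Longrightarrow> \<exists>c. 0 < val c \<and> val c < \<epsilon>"
  | c where "0 < val c" "\<And>z. 0 < val z \<Longrightarrow> val c \<le> val z"
proof (cases "\<forall>\<epsilon>>0. \<exists>c. 0 < val c \<and> val c < \<epsilon>")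
  case True then show ?thesis using that(1) by blast
next
  case False
  then obtain \<epsilon> where \<epsilon>: "0 < \<epsilon>" "\<And>c. 0 < val c \<Longrightarrow> \<epsilon> \<le> val c" by force
  obtain c where c: "0 < val c" "\<And>z. \<bar>val z\<bar> < val c \<Longrightarrow> \<bar>val z\<bar> < \<epsilon>"
    using ex_small_or_minimal[OF assms \<epsilon>(1)] by blast
  have "val c \<le> val z" if "0 < val z" for z using c(2)[of z] \<epsilon>(2)[OF that] that by force
  then show ?thesis using that(2) c(1) by blast
qed

theorem regular_principal_kernels_const_generated:
  "principal_kernels_const F \<inter> regular_kernels F =
    (lattice_gen F (principal_kernels_const F \<inter> regular_kernels F \<inter> corner_internal_kernels F)
      :: (('n::finite \<Rightarrow> 'a) \<Rightarrow> 'a) set set)"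
proof
  show "lattice_gen F (principal_kernels_const F \<inter> regular_kernels F \<inter> corner_internal_kernels F) \<subseteq>
    (principal_kernels_const F \<inter> regular_kernels F :: (('n \<Rightarrow> 'a) \<Rightarrow> 'a) set set)"
    unfolding regular_principal_kernels_const_eq
  proof (rule lattice_gen_subset)
    fix \<phi> \<psi> :: "('n \<Rightarrow> 'a) \<Rightarrow> real"
    assume rat: "\<phi> \<in> rat_vals" "\<psi> \<in> rat_vals"
    assume *: "(\<exists>N. \<forall>a. \<bar>\<phi> a\<bar> \<le> N) \<and> reg \<phi>" "(\<exists>N. \<forall>a. \<bar>\<psi> a\<bar> \<le> N) \<and> reg \<psi>"
    then obtain M N where MN: "\<And>a. \<bar>\<phi> a\<bar> \<le> M" "\<And>a. \<bar>\<psi> a\<bar> \<le> N" by blast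
    have "reg (\<lambda>a. \<bar>\<phi> a\<bar> + \<bar>\<psi> a\<bar>)"
    proof (rule reg_mono)
      show "reg \<phi>" using * by blast
      show "\<phi> a = 0" if "\<bar>\<phi> a\<bar> + \<bar>\<psi> a\<bar> = 0" for a using that by linarith
    qed
    then show "(\<exists>N. \<forall>a. \<bar>\<bar>\<phi> a\<bar> + \<bar>\<psi> a\<bar>\<bar> \<le> N) \<and> reg (\<lambda>a. \<bar>\<phi> a\<bar> + \<bar>\<psi> a\<bar>)"
      using add_mono[OF MN] by (intro conjI exI[of _ "M + N"]) simp_all
    have "reg (\<lambda>a. min \<bar>\<phi> a\<bar> \<bar>\<psi> a\<bar>)" using * rat by (intro reg_min) blast+
    then show "(\<exists>N. \<forall>a. \<bar>min \<bar>\<phi> a\<bar> \<bar>\<psi> a\<bar>\<bar> \<le> N) \<and> reg (\<lambda>a. min \<bar>\<phi> a\<bar> \<bar>\<psi> a\<bar>)"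
      using MN(1) by (intro conjI exI[of _ M]) (simp_all add: min.coboundedI1)
  qed blast
  show "(principal_kernels_const F \<inter> regular_kernels F :: (('n \<Rightarrow> 'a) \<Rightarrow> 'a) set set) \<subseteq>
    lattice_gen F (principal_kernels_const F \<inter> regular_kernels F \<inter> corner_internal_kernels F)"
  proof
    fix K :: "(('n \<Rightarrow> 'a) \<Rightarrow> 'a) set" assume K: "K \<in> principal_kernels_const F \<inter> regular_kernels F"
    then obtain \<phi> N where \<phi>: "K = ideal \<phi>" "\<phi> \<in> rat_vals" "\<And>a. \<bar>\<phi> a\<bar> \<le> N" "reg \<phi>"
      unfolding regular_principal_kernels_const_eq by blast
    \<comment> \<open>Over the trivial value group the only value function is 0, which is not
      regular because the whole space is open.\<close>
    have "\<exists>c. 0 < val c"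
    proof (rule ccontr)
      assume "\<nexists>c. 0 < val c"
      then have "\<phi> = (\<lambda>_. 0)" by (rule rat_vals_trivial[OF \<phi>(2)])
      then show False using regD[OF \<phi>(4) _ openin_topspace] by (simp add: topspace_point_topology)
    qed
    then obtain c0 where c0: "0 < val c0" by blast
    then show "K \<in> lattice_gen F (principal_kernels_const F \<inter> regular_kernels F \<inter> corner_internal_kernels F)"
    proof (cases rule: dense_or_discrete)
      case 1 then show ?thesis using regular_in_lattice_gen[OF \<phi>(2,4,3) c0] \<phi>(1) by blast
    next
      case (2 c)
      \<comment> \<open>In the discrete case \<open>K\<close> is the kernel of the constant
        \<open>c\<close>, hence already a generator.\<close>
      then have "K \<in> corner_internal_kernels F"
        using regular_discrete[OF \<phi>(2,4,3) 2] const_corner_internal[of c] \<phi>(1) by simp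
      then show ?thesis using K by (intro lattice_gen.base) blast
    qed
  qed
qed

end

theorem theorem8p0p5:
  fixes F :: "'a::{comm_semiring,comm_monoid_mult} nu_structure"
  assumes "nu_semifield F"
    and "nu_bipotent F"
    and "nu_archimedean F"
    and "nu_complete F"
  shows "(principal_kernels_const F :: (('n::finite \<Rightarrow> 'a) \<Rightarrow> 'a) set set) =
           lattice_gen F (principal_kernels_const F \<inter> corner_internal_kernels F)
       \<and> (principal_kernels_const F \<inter> regular_kernels F :: (('n \<Rightarrow> 'a) \<Rightarrow> 'a) set set) =
           lattice_gen F (principal_kernels_const F \<inter> regular_kernels F \<inter> corner_internal_kernels F)"
proof -
  interpret archimedean_nu_semifield F
    using assms by (simp add: archimedean_nu_semifield_def archimedean_nu_semifield_axioms_def)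
  obtain v :: "'a \<Rightarrow> real" where v: "\<And>a b. v (a * b) = v a + v b" "\<And>a b. nu_le F a b \<longleftrightarrow> v a \<le> v b"
    using ex_valuation by blast
  interpret valued_nu_semifield F v
    using v by unfold_locales
  show ?thesis
    using principal_kernels_const_generated regular_principal_kernels_const_generated by blast
qed

end
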